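(* Let $\mathcal{X}=\mathcal{Y}=\mathbb{R}^n$ and let $\mu,\nu$ be Borel probability measures on $\mathbb{R}^n$. Suppose that the transition density is $$p(x,y)=\theta(|y-x|),\qquad x,y\in\mathbb{R}^n,$$ where $|\cdot|$ is the Euclidean norm and the function $\theta:[0,\infty)\to(0,\infty)$ is positive, bounded, continuous, and there exists some $L\ge0$ such that $\theta$ restricted to $[L,\infty)$ is non-increasing. Then the Schrödinger system $$\mathsf{a}(dx)\int_{\mathbb{R}^n}p(x,y)\,\mathsf{b}(dy)=\mu(dx),\qquad \mathsf{b}(dy)\int_{\mathbb{R}^n}p(x,y)\,\mathsf{a}(dx)=\nu(dy)$$ admits a unique solution $(\mathsf{a},\mathsf{b})$, uniqueness being understood up to the transformations $(\mathsf{a},\mathsf{b})\mapsto(\kappa^{-1}\mathsf{a},\kappa\mathsf{b})$, $\kappa>0$.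
   Context: A solution of the Schrödinger system is a pair $(\mathsf{a},\mathsf{b})$ of $\sigma$-finite nonnegative Borel measures on $\mathbb{R}^n$ satisfying the two displayed identities between measures. *)

theory Defs
  imports "HOL-Probability.Probability"
begin

text \<open>The measure \<open>a(dx) f(x)\<close> is \<open>density a f\<close>. The inner integrals take values in
  \<open>ennreal\<close>; where \<open>a\<close> is \<open>\<sigma>\<close>-finite and \<open>\<mu>\<close> is finite, the first identity forces
  them to be finite \<open>a\<close>-almost everywhere, and likewise for \<open>b\<close> and \<open>\<nu>\<close>.\<close>

definition schroedinger_solution ::
  "('a::topological_space \<Rightarrow> 'b::topological_space \<Rightarrow> real) \<Rightarrow> 'a measure \<Rightarrow> 'b measure
    \<Rightarrow> 'a measure \<Rightarrow> 'b measure \<Rightarrow> bool" where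
  "schroedinger_solution p \<mu> \<nu> a b \<longleftrightarrow>
     sigma_finite_measure a \<and> sets a = sets borel \<and>
     sigma_finite_measure b \<and> sets b = sets borel \<and>
     density a (\<lambda>x. \<integral>\<^sup>+ y. ennreal (p x y) \<partial>b) = \<mu> \<and>
     density b (\<lambda>y. \<integral>\<^sup>+ x. ennreal (p x y) \<partial>a) = \<nu>"

end

theory Submission
  imports Defs "HOL-Complex_Analysis.Great_Picard"
begin

text \<open>Every solution has the form \<open>a = f \<mu>\<close>, \<open>b = g \<nu>\<close>, where \<open>f(x) p(x,y) g(y)\<close> is the density of a
  coupling of \<open>\<mu>\<close> and \<open>\<nu>\<close>. Uniqueness: comparing two such couplings on suitable bounded functions
  of \<open>x\<close> and of \<open>y\<close> forces \<open>f' g' = f g\<close> almost everywhere, and the variables separate.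

  Existence: if \<open>p\<close> is bounded away from zero, one Sinkhorn step contracts the ratio of two
  functions, so the iteration converges. In general, solve the system for \<open>p + 1 / (n + 1)\<close>. After
  normalising the mass of \<open>g\<^sub>n \<nu>\<close> on a fixed ball to be one, positivity of \<open>\<theta>\<close> on bounded intervals
  bounds \<open>f\<^sub>n\<close> and \<open>g\<^sub>n\<close> locally uniformly in \<open>n\<close>. Both have locally weakly convergent subsequences,
  and \<open>f\<^sub>n \<integral> p g\<^sub>n d\<nu>\<close> passes to the limit on bounded sets; since the couplings have the fixed
  marginals \<open>\<mu>\<close> and \<open>\<nu>\<close>, the mass outside a bounded set is uniformly small and no mass is lost.\<close>

section \<open>Uniqueness of the factors\<close>

text \<open>Two obstacles shape the existence proof. Since \<open>p\<close> may tend to zero at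
  large distances, the total masses of the approximating factors are not controlled; what survives
  are pointwise majorants \<open>F\<close> and \<open>G\<close>, possibly unbounded. They come from
  two sets \<open>A\<close>, \<open>B\<close> with \<mu>(A) + \<nu>(B) > 1. The scaling freedom sets
  the mass of the second measure on \<open>B\<close> to one, which bounds \<open>f\<close>; every
  coupling gives A x B at least the mass \<mu>(A) + \<nu>(B) - 1, which keeps the first measure of
  \<open>A\<close> away from zero and so bounds \<open>g\<close>. Moreover, a product of two weakly
  convergent sequences need not converge to the product of the limits. Here the kernel helps:
  integrating \<open>g\<close> against it turns weak convergence into pointwise convergence of the
  inner integral, and a bounded pointwise limit may be paired with the weak limit of
  \<open>f\<close>. This works on the sets where \<open>F\<close> and \<open>G\<close> are at most
  j; the fixed marginals allow j to grow afterwards.\<close>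

text \<open>The test functions \<open>(f' - f) / (f' + f)\<close> and \<open>(g' - g) / (g' + g)\<close> are bounded, so both
  couplings integrate their sum to the same value; but the difference of the couplings times this
  sum is \<open>2 p (f' g' - f g)\<^sup>2 / ((f' + f) (g' + g)) \<ge> 0\<close>.\<close>

lemma schroedinger_factors_unique:
  fixes M :: "'a measure" and N :: "'b measure" and p :: "'a \<Rightarrow> 'b \<Rightarrow> real"
  assumes "prob_space M" "prob_space N"
    and p[measurable]: "case_prod p \<in> borel_measurable (M \<Otimes>\<^sub>M N)" and p_pos: "\<And>x y. p x y > 0"
    and meas[measurable]: "f \<in> borel_measurable M" "f' \<in> borel_measurable M"
      "g \<in> borel_measurable N" "g' \<in> borel_measurable N"
    and pos: "\<And>x. f x > (0::real)" "\<And>x. f' x > (0::real)" "\<And>y. g y > (0::real)" "\<And>y. g' y > (0::real)"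
    and fM: "AE x in M. (\<integral>\<^sup>+y. ennreal (f x * p x y * g y) \<partial>N) = 1"
    and gN: "AE y in N. (\<integral>\<^sup>+x. ennreal (f x * p x y * g y) \<partial>M) = 1"
    and f'M: "AE x in M. (\<integral>\<^sup>+y. ennreal (f' x * p x y * g' y) \<partial>N) = 1"
    and g'N: "AE y in N. (\<integral>\<^sup>+x. ennreal (f' x * p x y * g' y) \<partial>M) = 1"
  obtains \<kappa> where "\<kappa> > 0" "AE x in M. f' x = inverse \<kappa> * f x" "AE y in N. g' y = \<kappa> * g y"
proof -
  interpret M: prob_space M by fact
  interpret N: prob_space N by fact
  interpret pair_prob_space M N ..
  let ?P = "M \<Otimes>\<^sub>M N"
  define u where "u x = (f' x - f x) / (f' x + f x)" for x
  define v where "v y = (g' y - g y) / (g' y + g y)" for y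
  have [measurable]: "u \<in> borel_measurable M" "v \<in> borel_measurable N"
    unfolding u_def v_def by measurable
  have quot: "\<bar>(b - a) / (b + a)\<bar> \<le> 1" if "a > 0" "b > 0" for a b :: real
    using that by (simp add: abs_le_iff divide_simps)
  have uv: "\<bar>u x\<bar> \<le> 1" "\<bar>v y\<bar> \<le> 1" for x y
    unfolding u_def v_def by (intro quot pos)+
  \<comment> \<open>Stated for arbitrary factors \<open>k\<close>, \<open>l\<close> because both
    couplings need it: the value depends on the marginals only, so it is the same for the
    two.\<close>
  have coupling: "integrable ?P (\<lambda>z. k (fst z) * p (fst z) (snd z) * l (snd z) * (u (fst z) + v (snd z)))"
    "(\<integral>z. k (fst z) * p (fst z) (snd z) * l (snd z) * (u (fst z) + v (snd z)) \<partial>?P)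
      = (\<integral>x. u x \<partial>M) + (\<integral>y. v y \<partial>N)"
    if [measurable]: "k \<in> borel_measurable M" "l \<in> borel_measurable N"
      and kl: "\<And>x. k x > 0" "\<And>y. l y > 0"
      and kM: "AE x in M. (\<integral>\<^sup>+y. ennreal (k x * p x y * l y) \<partial>N) = 1"
      and lN: "AE y in N. (\<integral>\<^sup>+x. ennreal (k x * p x y * l y) \<partial>M) = 1" for k l
  proof -
    define w where "w z = k (fst z) * p (fst z) (snd z) * l (snd z)" for z
    have w[measurable]: "w \<in> borel_measurable ?P"
      unfolding w_def using p by (simp add: case_prod_beta')
    have w_pos: "w z > 0" for z unfolding w_def using kl p_pos by simp
    have w_nonneg: "0 \<le> w z" for z using w_pos[of z] by simp
    have "(\<integral>\<^sup>+z. ennreal (w z) \<partial>?P) = (\<integral>\<^sup>+x. \<integral>\<^sup>+y. ennreal (w (x, y)) \<partial>N \<partial>M)"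
      by (rule N.nn_integral_fst[symmetric]) measurable
    also have "\<dots> = (\<integral>\<^sup>+x. 1 \<partial>M)"
      unfolding w_def using kM by (intro nn_integral_cong_AE) auto
    finally have "(\<integral>\<^sup>+z. ennreal (w z) \<partial>?P) = 1" by (simp add: M.emeasure_space_1)
    then have int_w: "integrable ?P w"
      by (intro integrableI_nonneg) (auto simp: w_nonneg)
    have int_u: "integrable ?P (\<lambda>z. w z * u (fst z))"
      by (rule Bochner_Integration.integrable_bound[OF int_w])
         (use uv in \<open>auto simp: abs_mult intro!: mult_right_le_one_le\<close>)
    have int_v: "integrable ?P (\<lambda>z. w z * v (snd z))"
      by (rule Bochner_Integration.integrable_bound[OF int_w])
         (use uv in \<open>auto simp: abs_mult intro!: mult_right_le_one_le\<close>)
    have kM': "AE x in M. (\<integral>y. w (x, y) \<partial>N) = 1"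
      using kM AE_space
    proof eventually_elim
      case (elim x)
      have "(\<lambda>y. w (x, y)) \<in> borel_measurable N"
        by (rule measurable_compose[OF measurable_Pair1'[OF elim(2)] w])
      then show ?case
        using elim(1) by (subst integral_eq_nn_integral) (auto simp: w_nonneg, simp add: w_def)
    qed
    have lN': "AE y in N. (\<integral>x. w (x, y) \<partial>M) = 1"
      using lN AE_space
    proof eventually_elim
      case (elim y)
      have "(\<lambda>x. w (x, y)) \<in> borel_measurable M"
        by (rule measurable_compose[OF measurable_Pair2'[OF elim(2)] w])
      then show ?case
        using elim(1) by (subst integral_eq_nn_integral) (auto simp: w_nonneg, simp add: w_def)
    qed
    have "(\<integral>z. w z * u (fst z) \<partial>?P) = (\<integral>x. \<integral>y. w (x, y) * u x \<partial>N \<partial>M)"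
      using integral_fst'[OF int_u] by simp
    also have "\<dots> = (\<integral>x. u x \<partial>M)"
      using kM' by (intro integral_cong_AE) auto
    finally have "(\<integral>z. w z * u (fst z) \<partial>?P) = (\<integral>x. u x \<partial>M)" .
    moreover have "(\<integral>z. w z * v (snd z) \<partial>?P) = (\<integral>y. \<integral>x. w (x, y) * v y \<partial>M \<partial>N)"
      using integral_snd[of "\<lambda>x y. w (x, y) * v y"] int_v by (simp add: case_prod_beta')
    moreover have "\<dots> = (\<integral>y. v y \<partial>N)"
      using lN' by (intro integral_cong_AE) auto
    ultimately show "integrable ?P (\<lambda>z. k (fst z) * p (fst z) (snd z) * l (snd z) * (u (fst z) + v (snd z)))"
      "(\<integral>z. k (fst z) * p (fst z) (snd z) * l (snd z) * (u (fst z) + v (snd z)) \<partial>?P)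
        = (\<integral>x. u x \<partial>M) + (\<integral>y. v y \<partial>N)"
      using int_u int_v unfolding w_def[symmetric] by (simp_all add: distrib_left)
  qed
  define D where "D z = 2 * p (fst z) (snd z) * (f' (fst z) * g' (snd z) - f (fst z) * g (snd z))\<^sup>2
    / ((f' (fst z) + f (fst z)) * (g' (snd z) + g (snd z)))" for z
  have D_eq: "D z = f' (fst z) * p (fst z) (snd z) * g' (snd z) * (u (fst z) + v (snd z))
      - f (fst z) * p (fst z) (snd z) * g (snd z) * (u (fst z) + v (snd z))" for z
  proof -
    obtain x y where z: "z = (x, y)" by (cases z)
    have nz: "f' x + f x \<noteq> 0" "g' y + g y \<noteq> 0"
      using pos by (metis add_pos_pos less_irrefl)+
    have "u x + v y = 2 * (f' x * g' y - f x * g y) / ((f' x + f x) * (g' y + g y))"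
      unfolding u_def v_def add_frac_eq[OF nz] by (simp add: algebra_simps)
    moreover have "f' x * p x y * g' y * (u x + v y) - f x * p x y * g y * (u x + v y)
        = p x y * (f' x * g' y - f x * g y) * (u x + v y)"
      by (simp add: algebra_simps)
    ultimately show ?thesis
      unfolding z D_def by (simp add: power2_eq_square)
  qed
  have D_nonneg: "0 \<le> D z" for z
    unfolding D_def using pos p_pos
    by (intro divide_nonneg_nonneg mult_nonneg_nonneg add_nonneg_nonneg less_imp_le[OF pos(1)]
        less_imp_le[OF pos(2)] less_imp_le[OF pos(3)] less_imp_le[OF pos(4)] less_imp_le[OF p_pos]) auto
  have int_D: "integrable ?P D" and "integral\<^sup>L ?P D = 0"
    unfolding D_eq[abs_def]
    using coupling[OF meas(2,4) pos(2,4) f'M g'N] coupling[OF meas(1,3) pos(1,3) fM gN]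
    by (auto simp: Bochner_Integration.integral_diff)
  then have "AE z in ?P. D z = 0"
    using integral_nonneg_eq_0_iff_AE D_nonneg by blast
  then have "AE z in ?P. f' (fst z) * g' (snd z) = f (fst z) * g (snd z)"
  proof eventually_elim
    case (elim z)
    have "f' (fst z) + f (fst z) > 0" "g' (snd z) + g (snd z) > 0"
      using pos by (simp_all add: add_pos_pos)
    then show ?case using elim p_pos[of "fst z" "snd z"] unfolding D_def by simp
  qed
  then have AE2: "AE x in M. AE y in N. f' x * g' y = f x * g y"
    using AE_pair by force
  then obtain x0 where x0: "AE y in N. f' x0 * g' y = f x0 * g y"
    using eventually_happens M.ae_filter_bot by blast
  \<comment> \<open>The product identity is frozen at one generic point \<open>x0\<close>, which
    gives the constant for \<open>g'\<close>. For almost every \<open>x\<close> some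
    \<open>y\<close> satisfies both identities, and \<open>g y > 0\<close> then cancels.\<close>
  define \<kappa> where "\<kappa> = f x0 / f' x0"
  have \<kappa>: "\<kappa> > 0" unfolding \<kappa>_def using pos by simp
  have g': "AE y in N. g' y = \<kappa> * g y"
    using x0 by eventually_elim
      (use pos(2)[of x0] in \<open>simp add: \<kappa>_def field_simps\<close>)
  have f': "AE x in M. f' x = inverse \<kappa> * f x"
    using AE2
  proof eventually_elim
    case (elim x)
    then have "AE y in N. f' x * g' y = f x * g y \<and> g' y = \<kappa> * g y"
      using g' by eventually_elim auto
    then obtain y where "f' x * g' y = f x * g y" "g' y = \<kappa> * g y"
      using eventually_happens N.ae_filter_bot by blast
    then show ?case using pos(3)[of y] \<kappa> by (simp add: field_simps)
  qed
  show thesis by (rule that[OF \<kappa> f' g'])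
qed

section \<open>Weak compactness of bounded functions\<close>

text \<open>Serves the compactness proof below: countability permits a diagonal extraction,
  stability under intersections permits the Dynkin induction, and \<open>UNIV\<close> is what its
  complement step needs. Finite intersections of a countable basis do all three, with
  \<open>UNIV\<close> as the empty intersection.\<close>

lemma borel_countable_Int_stable_generator:
  obtains G :: "'a::second_countable_topology set set"
  where "countable G" "Int_stable G" "UNIV \<in> G" "sets borel = sigma_sets UNIV G"
proof -
  obtain B :: "'a set set" where B: "countable B" "topological_basis B"
    using ex_countable_basis by blast
  define G where "G = Inter ` {F. finite F \<and> F \<subseteq> B}"
  have "countable G"
    unfolding G_def by (intro countable_image countable_Collect_finite_subset B)
  moreover have "Int_stable G"
  proof (rule Int_stableI)
    fix a b assume "a \<in> G" "b \<in> G"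
    then obtain F F' where "finite F" "F \<subseteq> B" "a = \<Inter>F" "finite F'" "F' \<subseteq> B" "b = \<Inter>F'"
      unfolding G_def by auto
    then have "a \<inter> b = \<Inter>(F \<union> F')" "finite (F \<union> F')" "F \<union> F' \<subseteq> B"
      by auto
    then show "a \<inter> b \<in> G" unfolding G_def by blast
  qed
  moreover have UNIV: "UNIV \<in> G"
    unfolding G_def by (rule image_eqI[of _ _ "{}"]) auto
  moreover have "sets borel = sigma_sets UNIV G"
  proof -
    have "sets borel = sigma_sets UNIV B"
      by (simp add: borel_eq_countable_basis[OF B])
    moreover have "B \<subseteq> G"
      unfolding G_def by (auto intro!: image_eqI[of _ _ "{_}"])
    moreover have "G \<subseteq> sets borel"
    proof
      fix g assume "g \<in> G"
      then obtain F where "finite F" "F \<subseteq> B" "g = \<Inter>F" unfolding G_def by auto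
      then have "open g"
        using B(2) topological_basis_open by (auto intro!: open_Inter)
      then show "g \<in> sets borel" by simp
    qed
    ultimately show ?thesis
      by (metis sets.sigma_sets_eq sigma_sets_mono' sigma_sets_subseteq space_borel
          sets.sigma_sets_subset subset_antisym)
  qed
  ultimately show thesis by (rule that)
qed

text \<open>Sequential weak-star compactness of the order interval [0, 1] in L-infinity, tested
  against L1. A diagonal subsequence converges on a countable generator; domination by
  \<open>M\<close> carries the convergence to all Borel sets, where the limit is a measure below
  \<open>M\<close>; its Radon-Nikodym density is the weak limit.\<close>

lemma bounded_functions_weak_compact:
  fixes M :: "'a::second_countable_topology measure" and h :: "nat \<Rightarrow> 'a \<Rightarrow> real"
  assumes "finite_measure M" and M: "sets M = sets borel"
    and meas[measurable]: "\<And>n. h n \<in> borel_measurable M"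
    and h: "\<And>n x. 0 \<le> h n x" "\<And>n x. h n x \<le> 1"
  obtains r h' where "strict_mono (r :: nat \<Rightarrow> nat)" "h' \<in> borel_measurable M"
    "\<And>x. 0 \<le> h' x" "\<And>x. h' x \<le> 1"
    "\<And>\<psi>. integrable M \<psi> \<Longrightarrow>
      (\<lambda>n. \<integral>x. h (r n) x * \<psi> x \<partial>M) \<longlonglongrightarrow> (\<integral>x. h' x * (\<psi> x :: real) \<partial>M)"
proof -
  interpret finite_measure M by fact
  define Q where "Q n A = (\<integral>x. h n x * indicator A x \<partial>M)" for n A
  have int: "integrable M (\<lambda>x. h n x * indicator A x)" if "A \<in> sets M" for n A
    using that h by (intro integrable_const_bound[of _ 1]) (auto simp: indicator_def)
  have Q_nonneg: "0 \<le> Q n A" for n A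
    unfolding Q_def using h by (intro integral_nonneg_AE) (auto simp: indicator_def)
  have Q_le: "Q n A \<le> measure M A" if "A \<in> sets M" for n A
  proof -
    have "Q n A \<le> (\<integral>x. indicator A x \<partial>M)"
      unfolding Q_def using that h int[OF that]
      by (intro integral_mono integrable_real_indicator)
        (auto simp: indicator_def less_top[symmetric])
    then show ?thesis using that by simp
  qed
  have Q_UN: "(\<lambda>i. Q n (F i)) sums Q n (\<Union>i. F i)"
    if F: "range F \<subseteq> sets M" "disjoint_family F" for n F
  proof -
    have [measurable]: "F i \<in> sets M" for i using F by auto
    have eq: "(LINT x:A|M. h n x) = Q n A" for A
      unfolding Q_def set_lebesgue_integral_def by (simp add: mult.commute)
    have "(\<lambda>i. LINT x:F i|M. h n x) sums (LINT x:(\<Union>i. F i)|M. h n x)"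
    proof -
      have "set_integrable M (\<Union>i. F i) (h n)"
        using int[of "\<Union>i. F i" n] unfolding set_integrable_def by (simp add: mult.commute)
      moreover have "F i \<inter> F j = {}" if "i \<noteq> j" for i j
        using F(2) that by (auto simp: disjoint_family_on_def)
      moreover have "summable (\<lambda>i. LINT x:F i|M. h n x)"
        unfolding eq
        by (rule summable_comparison_test'[OF sums_summable[OF finite_measure_UNION[OF F]]])
           (use Q_nonneg Q_le in auto)
      ultimately show ?thesis
        using lebesgue_integral_countable_add[of F M "h n"] by (simp add: sums_iff)
    qed
    then show ?thesis by (simp add: eq)
  qed
  obtain G :: "'a set set" where G: "countable G" "Int_stable G" "UNIV \<in> G"
    and gen: "sets borel = sigma_sets UNIV G"
    by (rule borel_countable_Int_stable_generator)
  have "norm (Q n A) \<le> measure M (space M)" if "A \<in> G" for n A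
    using Q_nonneg[of n A] Q_le[of A n] bounded_measure[of A] that
    by (metis G(2) M Q_le dual_order.trans gen norm_of_real of_real_eq_id id_apply abs_of_nonneg real_norm_def sigma_sets.Basic)
  then obtain r :: "nat \<Rightarrow> nat" where r: "strict_mono r"
    and conv_G: "\<And>A. A \<in> G \<Longrightarrow> \<exists>l. (\<lambda>n. Q (r n) A) \<longlonglongrightarrow> l"
    using function_convergent_subsequence[OF G(1), of Q "measure M (space M)"] by metis
  have summ: "summable (\<lambda>i. measure M (F i))"
    if "range F \<subseteq> sets M" "disjoint_family F" for F
    using finite_measure_UNION[OF that] by (rule sums_summable)
  \<comment> \<open>The bounds \<open>measure M (F i)\<close> are summable and independent of
    \<open>n\<close>, so limit and sum may be exchanged. This is used twice: for disjoint unions in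
    the induction, and for the countable additivity of the limit \<open>m\<close>.\<close>
  have tannery: "(\<lambda>n. Q (r n) (\<Union>i. F i)) \<longlonglongrightarrow> (\<Sum>i. l i)" "summable l"
    if F: "range F \<subseteq> sets M" "disjoint_family F"
      and l: "\<And>i. (\<lambda>n. Q (r n) (F i)) \<longlonglongrightarrow> l i" for F l
  proof -
    have bnd: "norm (Q n (F i)) \<le> measure M (F i)" for n i
      using Q_nonneg[of n "F i"] Q_le[of "F i" n] F(1) by auto
    have "(\<lambda>n. \<Sum>i. Q (r n) (F i)) \<longlonglongrightarrow> (\<Sum>i. l i)"
      by (rule tannerys_theorem[where M="\<lambda>i. measure M (F i)", THEN conjunct2, THEN conjunct2])
         (use l bnd summ[OF F] in \<open>auto intro!: always_eventually\<close>)
    then show "(\<lambda>n. Q (r n) (\<Union>i. F i)) \<longlonglongrightarrow> (\<Sum>i. l i)"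
      using Q_UN[OF F] by (simp add: sums_iff)
    have "norm (l i) \<le> measure M (F i)" for i
      by (rule LIMSEQ_le_const2[OF tendsto_norm[OF l]]) (use bnd in auto)
    then show "summable l"
      by (intro summable_comparison_test'[OF summ[OF F]])
  qed
  have conv: "\<exists>l. (\<lambda>n. Q (r n) A) \<longlonglongrightarrow> l" if "A \<in> sets M" for A
  proof -
    have "G \<subseteq> Pow UNIV" "A \<in> sigma_sets UNIV G" using that M gen by simp_all
    with G(2) show ?thesis
    proof (induction rule: sigma_sets_induct_disjoint)
      case (basic A) then show ?case by (rule conv_G)
    next
      case empty then show ?case by (auto simp: Q_def)
    next
      case (compl A)
      then obtain l where l: "(\<lambda>n. Q (r n) A) \<longlonglongrightarrow> l" by auto
      obtain l' where l': "(\<lambda>n. Q (r n) UNIV) \<longlonglongrightarrow> l'" using conv_G[OF G(3)] by auto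
      have A: "A \<in> sets M" using compl M gen by simp
      have "Q n (UNIV - A) = Q n UNIV - Q n A" for n
      proof -
        have "Q n (UNIV - A) = (\<integral>x. h n x * indicator UNIV x - h n x * indicator A x \<partial>M)"
          unfolding Q_def by (intro Bochner_Integration.integral_cong) (auto simp: indicator_def)
        also have "\<dots> = Q n UNIV - Q n A"
          unfolding Q_def using int[OF A, of n] int[of UNIV n] M
          by (intro Bochner_Integration.integral_diff) auto
        finally show ?thesis .
      qed
      then show ?case using tendsto_diff[OF l' l] by auto
    next
      case (union F)
      then obtain l where "\<And>i. (\<lambda>n. Q (r n) (F i)) \<longlonglongrightarrow> l i" by metis
      moreover have "range F \<subseteq> sets M" using union M gen by auto
      ultimately show ?case using tannery(1) union by blast
    qed
  qed
  define m where "m A = lim (\<lambda>n. Q (r n) A)" for A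
  have m: "(\<lambda>n. Q (r n) A) \<longlonglongrightarrow> m A" if "A \<in> sets M" for A
    using conv[OF that] unfolding m_def by (simp add: convergent_def flip: convergent_LIMSEQ_iff)
  have m_nonneg: "0 \<le> m A" if "A \<in> sets M" for A
    by (rule LIMSEQ_le_const[OF m[OF that]]) (use Q_nonneg in auto)
  have m_le: "m A \<le> measure M A" if "A \<in> sets M" for A
    by (rule LIMSEQ_le_const2[OF m[OF that]]) (use Q_le[OF that] in auto)
  have m_empty: "m {} = 0" unfolding m_def Q_def by simp
  define N where "N = measure_of (space M) (sets M) (\<lambda>A. ennreal (m A))"
  have setsN: "sets N = sets M" unfolding N_def by simp
  have N: "emeasure N A = ennreal (m A)" if "A \<in> sets M" for A
  proof (rule emeasure_measure_of[OF N_def])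
    show "countably_additive (sets N) (\<lambda>A. ennreal (m A))"
    proof (rule countably_additiveI)
      fix F :: "nat \<Rightarrow> 'a set" assume F: "range F \<subseteq> sets N" "disjoint_family F" "(\<Union>i. F i) \<in> sets N"
      then have FM: "range F \<subseteq> sets M" "\<And>i. F i \<in> sets M" by (auto simp: setsN)
      have "m (\<Union>i. F i) = (\<Sum>i. m (F i))" "summable (\<lambda>i. m (F i))"
        using tannery[OF FM(1) F(2), of "\<lambda>i. m (F i)"] m[OF FM(2)] m[of "\<Union>i. F i"] F(3)
        by (auto simp: setsN intro: LIMSEQ_unique)
      then show "(\<Sum>i. ennreal (m (F i))) = ennreal (m (\<Union>i. F i))"
        using m_nonneg FM(2) by (simp add: suminf_ennreal2)
    qed
  qed (use that sets.space_closed m_empty in \<open>auto simp: setsN positive_def\<close>)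
  have "absolutely_continuous M N"
    unfolding absolutely_continuous_def
  proof safe
    fix A assume A: "A \<in> null_sets M"
    then have "m A = 0"
      using m_le[of A] m_nonneg[of A] by (auto simp: null_sets_def measure_def)
    with A show "A \<in> null_sets N" by (auto simp: null_sets_def setsN N)
  qed
  moreover have "finite_measure N"
    by (rule finite_measureI) (metis N ennreal_neq_top infinity_ennreal_def sets.top setsN sets_eq_imp_space_eq)
  ultimately obtain d where d[measurable]: "d \<in> borel_measurable M" and dN: "density M d = N"
    using Radon_Nikodym_finite_measure[of N] setsN by blast
  have fin: "(\<integral>\<^sup>+x. d x \<partial>M) \<noteq> \<infinity>"
  proof -
    have "(\<integral>\<^sup>+x. d x \<partial>M) = emeasure (density M d) (space M)"
      by (simp add: emeasure_density cong: nn_integral_cong)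
    then show ?thesis using dN N by auto
  qed
  then have d_fin: "AE x in M. d x \<noteq> \<infinity>"
    by (intro nn_integral_noteq_infinite) auto
  \<comment> \<open>The density is finite almost everywhere, so sending the value \<infinity> to 0
    changes it on a null set only.\<close>
  define e where "e x = enn2real (d x)" for x
  have e[measurable]: "e \<in> borel_measurable M" unfolding e_def by measurable
  have e_nonneg: "0 \<le> e x" for x unfolding e_def by simp
  have de: "AE x in M. d x = ennreal (e x)"
    using d_fin unfolding e_def by eventually_elim (simp add: less_top)
  have int_e: "integrable M e"
  proof (rule integrableI_nonneg)
    have "(\<integral>\<^sup>+x. ennreal (e x) \<partial>M) = (\<integral>\<^sup>+x. d x \<partial>M)"
      using de by (intro nn_integral_cong_AE) auto
    then show "(\<integral>\<^sup>+x. ennreal (e x) \<partial>M) < \<infinity>" using fin by (simp add: less_top)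
  qed (use e_nonneg in auto)
  have e_m: "(\<integral>x. e x * indicator A x \<partial>M) = m A" if A: "A \<in> sets M" for A
  proof (rule integral_eq_nn_integral[THEN trans])
    have "(\<integral>\<^sup>+x. ennreal (e x * indicator A x) \<partial>M) = (\<integral>\<^sup>+x. d x * indicator A x \<partial>M)"
      using de by (intro nn_integral_cong_AE) (auto simp: indicator_def)
    also have "\<dots> = ennreal (m A)"
      using A N[OF A] unfolding dN[symmetric] by (simp add: emeasure_density)
    finally show "enn2real (\<integral>\<^sup>+x. ennreal (e x * indicator A x) \<partial>M) = m A"
      using m_nonneg[OF A] by simp
  qed (use A e_nonneg in auto)
  \<comment> \<open>The integral of \<open>1 - e\<close> over any \<open>A\<close> is
    \<open>measure M A - m A\<close>, which is nonnegative; a function with this property on all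
    sets is nonnegative almost everywhere.\<close>
  have "AE x in M. 0 \<le> 1 - e x"
  proof (rule density_nonneg)
    show "integrable M (\<lambda>x. 1 - e x)" using int_e by simp
    fix A assume A: "A \<in> sets M"
    have "(LINT x:A|M. 1 - e x) = (\<integral>x. indicator A x - e x * indicator A x \<partial>M)"
      unfolding set_lebesgue_integral_def
      by (intro Bochner_Integration.integral_cong) (auto simp: indicator_def)
    also have "\<dots> = measure M A - m A"
      using A int_e by (subst Bochner_Integration.integral_diff)
        (auto simp: e_m integrable_real_mult_indicator less_top[symmetric])
    finally show "0 \<le> (LINT x:A|M. 1 - e x)" using m_le[OF A] by simp
  qed
  then have e_le: "AE x in M. e x = min 1 (e x)" by eventually_elim auto
  \<comment> \<open>Truncation makes the upper bound hold at every point, at the price of a change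
    on a null set.\<close>
  define h' where "h' x = min 1 (e x)" for x
  have h'[measurable]: "h' \<in> borel_measurable M" unfolding h'_def by measurable
  have h'01: "0 \<le> h' x" "h' x \<le> 1" for x unfolding h'_def using e_nonneg by auto
  have h'_m: "(\<integral>x. h' x * indicator A x \<partial>M) = m A" if A[measurable]: "A \<in> sets M" for A
    unfolding e_m[OF A, symmetric] h'_def
    by (rule integral_cong_AE) (use e_le in \<open>auto simp: indicator_def\<close>)
  have int_mult: "integrable M (\<lambda>x. k x * \<psi> x)"
    if "integrable M \<psi>" "k \<in> borel_measurable M" "\<And>x. 0 \<le> k x" "\<And>x. k x \<le> 1"
    for k \<psi> :: "'a \<Rightarrow> real"
    by (rule Bochner_Integration.integrable_bound[OF that(1)])
       (use that in \<open>auto simp: abs_mult intro!: mult_left_le_one_le\<close>)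
  have "(\<lambda>n. \<integral>x. h (r n) x * \<psi> x \<partial>M) \<longlonglongrightarrow> (\<integral>x. h' x * \<psi> x \<partial>M)"
    if "integrable M \<psi>" for \<psi> :: "'a \<Rightarrow> real"
    using that
  proof (induction rule: integrable_induct)
    case (base A c)
    have "(\<lambda>n. Q (r n) A * c) \<longlonglongrightarrow> m A * c" by (intro tendsto_intros m base)
    then show ?case
      using h'_m[OF base(1)] by (simp add: Q_def mult.assoc[symmetric])
  next
    case (add f g)
    then show ?case
      using tendsto_add[OF add(3,4)]
      by (simp add: distrib_left int_mult h h'01)
  next
    case (lim f s)
    have s_lim: "(\<lambda>i. s i x) \<longlonglongrightarrow> f x" "norm (s i x) \<le> 2 * norm (f x)" if "x \<in> space M" for i x
      using lim that by auto
    have s_conv: "(\<lambda>n. \<integral>x. h (r n) x * s i x \<partial>M) \<longlonglongrightarrow> (\<integral>x. h' x * s i x \<partial>M)" for i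
      using lim by blast
    \<comment> \<open>The error of replacing \<open>f\<close> by its approximant is at most their L1
      distance for every weight between 0 and 1, hence uniformly in \<open>n\<close> and also for
      the limit \<open>h'\<close>. That is what makes the three-epsilon argument work.\<close>
    have err: "\<bar>(\<integral>x. k x * f x \<partial>M) - (\<integral>x. k x * s i x \<partial>M)\<bar> \<le> (\<integral>x. \<bar>s i x - f x\<bar> \<partial>M)"
      if k: "k \<in> borel_measurable M" "\<And>x. 0 \<le> k x" "\<And>x. k x \<le> 1" for k i
    proof -
      have "(\<integral>x. k x * f x \<partial>M) - (\<integral>x. k x * s i x \<partial>M) = (\<integral>x. k x * (f x - s i x) \<partial>M)"
        using lim k by (simp add: right_diff_distrib int_mult)
      also have "\<bar>\<dots>\<bar> \<le> (\<integral>x. \<bar>k x * (f x - s i x)\<bar> \<partial>M)"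
        by (rule integral_abs_bound)
      also have "\<dots> \<le> (\<integral>x. \<bar>s i x - f x\<bar> \<partial>M)"
        using lim k
        by (intro integral_mono integrable_abs int_mult)
           (auto simp: abs_mult abs_minus_commute intro!: mult_left_le_one_le)
      finally show ?thesis .
    qed
    have "(\<lambda>i. \<integral>x. \<bar>s i x - f x\<bar> \<partial>M) \<longlonglongrightarrow> (\<integral>x. 0 \<partial>M)"
    proof (rule integral_dominated_convergence)
      \<comment> \<open>The approximants satisfy \<open>norm (s i x) \<le> 2 * norm (f x)\<close>;
        the difference costs one more \<open>\<bar>f x\<bar>\<close>.\<close>
      show "integrable M (\<lambda>x. 3 * \<bar>f x\<bar>)" using lim by auto
      show "AE x in M. (\<lambda>i. \<bar>s i x - f x\<bar>) \<longlonglongrightarrow> 0"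
        by (intro AE_I2 tendsto_rabs_zero LIM_zero s_lim)
      show "AE x in M. norm \<bar>s i x - f x\<bar> \<le> 3 * \<bar>f x\<bar>" for i
      proof (rule AE_I2)
        fix x assume "x \<in> space M"
        from s_lim(2)[OF this, of i] show "norm \<bar>s i x - f x\<bar> \<le> 3 * \<bar>f x\<bar>" by simp
      qed
    qed (use lim in auto)
    then have small: "(\<lambda>i. \<integral>x. \<bar>s i x - f x\<bar> \<partial>M) \<longlonglongrightarrow> 0" by simp
    show ?case
    proof (rule LIMSEQ_I)
      fix \<epsilon> :: real assume "0 < \<epsilon>"
      then obtain i where i: "(\<integral>x. \<bar>s i x - f x\<bar> \<partial>M) < \<epsilon> / 3"
        using LIMSEQ_D[OF small, of "\<epsilon> / 3"] by force
      obtain n0 where n0: "\<And>n. n \<ge> n0 \<Longrightarrow>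
          \<bar>(\<integral>x. h (r n) x * s i x \<partial>M) - (\<integral>x. h' x * s i x \<partial>M)\<bar> < \<epsilon> / 3"
        using LIMSEQ_D[OF s_conv[of i], of "\<epsilon> / 3"] \<open>0 < \<epsilon>\<close> by auto
      have "\<bar>(\<integral>x. h (r n) x * f x \<partial>M) - (\<integral>x. h' x * f x \<partial>M)\<bar> < \<epsilon>" if "n \<ge> n0" for n
        using err[of "h (r n)" i, OF meas h] err[of h' i, OF h' h'01] n0[OF that] i by linarith
      then show "\<exists>n0. \<forall>n\<ge>n0. norm ((\<integral>x. h (r n) x * f x \<partial>M) - (\<integral>x. h' x * f x \<partial>M)) < \<epsilon>"
        by auto
    qed
  qed
  with r h' h'01 show thesis by (rule that)
qed

section \<open>Kernels bounded away from zero\<close>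

text \<open>Apart from measurability, this says that the function is positive with a bounded
  logarithm. Any two such functions have a ratio between positive constants, and the class is
  preserved by the iteration. The bounds hold at every point, so that ratio estimates need no null
  sets.\<close>

definition bounded_away :: "'a measure \<Rightarrow> ('a \<Rightarrow> real) \<Rightarrow> bool" where
  "bounded_away M g \<longleftrightarrow> g \<in> borel_measurable M \<and> (\<exists>a>0. \<exists>b. \<forall>x. a \<le> g x \<and> g x \<le> b)"

lemma bounded_away_pos: "bounded_away M g \<Longrightarrow> 0 < g x"
  unfolding bounded_away_def by (meson less_le_trans)

lemma (in prob_space) bounded_away_integrable:
  assumes "bounded_away M g"
  shows "integrable M g"
proof -
  obtain a b where "g \<in> borel_measurable M" "0 < a" "\<And>x. a \<le> g x" "\<And>x. g x \<le> b"
    using assms unfolding bounded_away_def by blast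
  moreover have "\<bar>g x\<bar> \<le> b" for x
    using calculation(2) calculation(3,4)[of x] by simp
  ultimately show ?thesis
    by (intro integrable_const_bound[of _ b]) auto
qed

locale bounded_kernel = M: prob_space M + N: prob_space N
  for M :: "'a measure" and N :: "'b measure" +
  fixes p :: "'a \<Rightarrow> 'b \<Rightarrow> real" and c C :: real
  assumes space_M: "space M = UNIV" and space_N: "space N = UNIV"
    and p_measurable: "case_prod p \<in> borel_measurable (M \<Otimes>\<^sub>M N)"
    and c_pos: "0 < c" and lower: "\<And>x y. c \<le> p x y" and upper: "\<And>x y. p x y \<le> C"
begin

sublocale pair_prob_space M N ..

text \<open>The system is symmetric under exchange of the marginals, so each result on
  \<open>K\<close> also holds for the transposed kernel, which is the other half of an iteration
  step.\<close>

lemma swap: "bounded_kernel N M (\<lambda>y x. p x y) c C"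
proof
  show "(\<lambda>(y, x). p x y) \<in> borel_measurable (N \<Otimes>\<^sub>M M)"
    using measurable_pair_swap[OF p_measurable] by simp
qed (simp_all add: space_M space_N c_pos lower upper)

lemma p_pos: "0 < p x y"
  using c_pos lower less_le_trans by blast

lemma C_pos: "0 < C" and c_le_C: "c \<le> C"
  using p_pos lower upper by (meson less_le_trans order_trans)+

lemma p_section_measurable: "(\<lambda>y. p x y) \<in> borel_measurable N"
  using measurable_compose[OF measurable_Pair1' p_measurable, of x] by (simp add: space_M)

lemma integrable_p: "integrable N g \<Longrightarrow> integrable N (\<lambda>y. p x y * g y)"
  by (rule Bochner_Integration.integrable_bound[of N "\<lambda>y. C * g y"])
     (use p_section_measurable p_pos[of x] upper[of x] C_pos in
       \<open>auto simp: abs_mult abs_of_pos intro!: AE_I2 mult_right_mono\<close>)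

definition K :: "('b \<Rightarrow> real) \<Rightarrow> 'a \<Rightarrow> real" where
  "K g x = (\<integral>y. p x y * g y \<partial>N)"

lemma K_measurable:
  assumes [measurable]: "g \<in> borel_measurable N"
  shows "K g \<in> borel_measurable M"
  unfolding K_def[abs_def]
  by (rule N.borel_measurable_lebesgue_integral) (use p_measurable in \<open>simp add: case_prod_beta'\<close>)

lemma K_bounds:
  assumes "integrable N g" "\<And>y. 0 \<le> g y"
  shows "c * (\<integral>y. g y \<partial>N) \<le> K g x" "K g x \<le> C * (\<integral>y. g y \<partial>N)"
proof -
  have "(\<integral>y. c * g y \<partial>N) \<le> K g x" "K g x \<le> (\<integral>y. C * g y \<partial>N)"
    unfolding K_def
    by (intro integral_mono mult_right_mono integrable_p integrable_mult_right assms lower upper)+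
  then show "c * (\<integral>y. g y \<partial>N) \<le> K g x" "K g x \<le> C * (\<integral>y. g y \<partial>N)" by simp_all
qed

lemma bounded_away_K:
  assumes "bounded_away N g"
  shows "bounded_away M (\<lambda>x. inverse (K g x))"
proof -
  obtain a b where g: "g \<in> borel_measurable N" "a > 0" "\<And>y. a \<le> g y" "\<And>y. g y \<le> b"
    using assms unfolding bounded_away_def by blast
  have int: "integrable N g" using assms by (rule N.bounded_away_integrable)
  have ab: "a \<le> (\<integral>y. g y \<partial>N)" "(\<integral>y. g y \<partial>N) \<le> b"
    using int g by (auto intro!: N.integral_ge_const N.integral_le_const)
  have K: "c * a \<le> K g x" "K g x \<le> C * b" for x
  proof -
    have "c * a \<le> c * (\<integral>y. g y \<partial>N)" "C * (\<integral>y. g y \<partial>N) \<le> C * b"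
      using ab c_pos C_pos by simp_all
    then show "c * a \<le> K g x" "K g x \<le> C * b"
      using K_bounds[OF int, of x] g(2,3) by (meson less_imp_le order_trans)+
  qed
  have "0 < c * a" using c_pos g(2) by simp
  then have "inverse (C * b) \<le> inverse (K g x)" "inverse (K g x) \<le> inverse (c * a)" for x
    using K[of x] by (auto intro!: le_imp_inverse_le simp del: inverse_mult_distrib)
  moreover have "0 < inverse (C * b)"
    using less_le_trans[OF less_le_trans[OF \<open>0 < c * a\<close> K(1)] K(2)]
    by (rule positive_imp_inverse_positive)
  ultimately show ?thesis
    using K_measurable[OF g(1)] unfolding bounded_away_def by fastforce
qed

text \<open>Doeblin: split \<open>p = c + (p - c)\<close>. The constant part contributes to \<open>K g'\<close> and \<open>K g\<close> in the
  ratio \<open>t\<close> of the integrals of \<open>g'\<close> and \<open>g\<close>, independently of \<open>x\<close>, and it carries at least the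
  fraction \<open>c / C\<close> of \<open>K g\<close>; the other part keeps the ratio between \<open>l\<close> and \<open>u\<close>.\<close>

lemma K_contraction:
  assumes g: "bounded_away N g" and g': "bounded_away N g'"
    and ratio: "\<And>y. l * g y \<le> g' y" "\<And>y. g' y \<le> u * g y"
  obtains l' u' where "l \<le> l'" "u' \<le> u" "u' - l' \<le> (1 - c / C) * (u - l)"
    "\<And>x. l' * K g x \<le> K g' x" "\<And>x. K g' x \<le> u' * K g x"
proof -
  note int = N.bounded_away_integrable[OF g] N.bounded_away_integrable[OF g']
  note pos = bounded_away_pos[OF g]
  define I I' where "I = (\<integral>y. g y \<partial>N)" and "I' = (\<integral>y. g' y \<partial>N)"
  obtain a b where ab: "a > 0" "\<And>y. a \<le> g y" using g unfolding bounded_away_def by blast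
  have "a \<le> I" unfolding I_def using int(1) ab(2) by (intro N.integral_ge_const) auto
  then have I_pos: "0 < I" using ab(1) by simp
  define t where "t = I' / I"
  have "(\<integral>y. l * g y \<partial>N) \<le> I'" "I' \<le> (\<integral>y. u * g y \<partial>N)"
    unfolding I'_def by (intro integral_mono integrable_mult_right int ratio)+
  then have t: "l \<le> t" "t \<le> u" "t * I = I'"
    unfolding t_def using I_pos by (simp_all add: I_def[symmetric] pos_le_divide_eq pos_divide_le_eq)
  let ?d = "c / C"
  have d: "0 \<le> ?d" "?d \<le> 1" using c_pos C_pos c_le_C by simp_all
  have K: "?d * K g x \<le> c * I" for x
    using K_bounds(2)[OF int(1) less_imp_le[OF pos], of x] C_pos c_pos unfolding I_def[symmetric]
    by (simp add: field_simps)
  \<comment> \<open>The new bounds are the averages \<open>(1 - ?d) * u + ?d * t\<close> and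
    \<open>(1 - ?d) * l + ?d * t\<close>, whose distance is exactly
    \<open>(1 - ?d) * (u - l)\<close>. Each comes from integrating a product of two nonnegative
    factors, one of them \<open>p x y - c\<close>.\<close>
  have up: "K g' x \<le> (u - ?d * (u - t)) * K g x" for x
  proof -
    have "0 \<le> (\<integral>y. (p x y - c) * (u * g y - g' y) \<partial>N)"
      using lower ratio by (intro integral_nonneg_AE) simp
    also have "\<dots> = (\<integral>y. u * (p x y * g y) - p x y * g' y - c * u * g y + c * g' y \<partial>N)"
      by (intro Bochner_Integration.integral_cong) (auto simp: algebra_simps)
    also have "\<dots> = u * K g x - K g' x - c * u * I + c * I'"
      unfolding K_def I_def I'_def using int integrable_p by simp
    finally have "K g' x \<le> u * K g x - (u - t) * (c * I)" unfolding t(3)[symmetric] by (simp add: algebra_simps)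
    also have "\<dots> \<le> u * K g x - (u - t) * (?d * K g x)"
      using K[of x] t by (intro diff_left_mono mult_left_mono) auto
    finally show ?thesis by (simp add: algebra_simps)
  qed
  have lo: "(l + ?d * (t - l)) * K g x \<le> K g' x" for x
  proof -
    have "0 \<le> (\<integral>y. (p x y - c) * (g' y - l * g y) \<partial>N)"
      using lower ratio by (intro integral_nonneg_AE) simp
    also have "\<dots> = (\<integral>y. p x y * g' y - l * (p x y * g y) + c * l * g y - c * g' y \<partial>N)"
      by (intro Bochner_Integration.integral_cong) (auto simp: algebra_simps)
    also have "\<dots> = K g' x - l * K g x + c * l * I - c * I'"
      unfolding K_def I_def I'_def using int integrable_p by simp
    finally have "l * K g x + (t - l) * (c * I) \<le> K g' x" unfolding t(3)[symmetric] by (simp add: algebra_simps)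
    moreover have "(t - l) * (?d * K g x) \<le> (t - l) * (c * I)"
      using K[of x] t by (intro mult_left_mono) auto
    ultimately show ?thesis by (simp add: algebra_simps)
  qed
  have "0 \<le> ?d * (t - l)" "0 \<le> ?d * (u - t)"
    using d(1) t(1,2) by (intro mult_nonneg_nonneg; simp)+
  then have "l \<le> l + ?d * (t - l)" "u - ?d * (u - t) \<le> u" by linarith+
  then show thesis
  proof (rule that[OF _ _ _ lo up])
    have "u - k * (u - t) - (l + k * (t - l)) \<le> (1 - k) * (u - l)" for k
      by (simp add: algebra_simps)
    then show "u - ?d * (u - t) - (l + ?d * (t - l)) \<le> (1 - ?d) * (u - l)" .
  qed
qed

text \<open>Inversion turns a ratio around, so exchanging \<open>g\<close> and \<open>g'\<close> in
  the conclusion keeps the very same bounds \<open>l'\<close> and \<open>u'\<close>, and their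
  distance stays contracted.\<close>

lemma inverse_K_contraction:
  assumes g: "bounded_away N g" and g': "bounded_away N g'"
    and ratio: "\<And>y. l * g y \<le> g' y" "\<And>y. g' y \<le> u * g y"
  obtains l' u' where "l \<le> l'" "u' \<le> u" "u' - l' \<le> (1 - c / C) * (u - l)"
    "\<And>x. l' * inverse (K g' x) \<le> inverse (K g x)" "\<And>x. inverse (K g x) \<le> u' * inverse (K g' x)"
proof -
  obtain l' u' where *: "l \<le> l'" "u' \<le> u" "u' - l' \<le> (1 - c / C) * (u - l)"
    "\<And>x. l' * K g x \<le> K g' x" "\<And>x. K g' x \<le> u' * K g x"
    using K_contraction[OF assms] by blast
  have pos: "0 < K g x" "0 < K g' x" for x
    using bounded_away_pos[OF bounded_away_K[OF g], of x] bounded_away_pos[OF bounded_away_K[OF g'], of x]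
    by simp_all
  have "l' * inverse (K g' x) \<le> inverse (K g x)" for x
    using *(4)[of x] pos[of x] by (simp add: divide_simps mult.commute)
  moreover have "inverse (K g x) \<le> u' * inverse (K g' x)" for x
    using *(5)[of x] pos[of x] by (simp add: divide_simps mult.commute)
  ultimately show thesis by (rule that[OF *(1-3)])
qed

lemma K_tendsto:
  assumes "\<And>k. G k \<in> borel_measurable N" "\<And>k y. \<bar>G k y\<bar> \<le> B" "\<And>y. (\<lambda>k. G k y) \<longlonglongrightarrow> g y"
  shows "(\<lambda>k. K (G k) x) \<longlonglongrightarrow> K g x"
  unfolding K_def
proof (rule integral_dominated_convergence)
  have "g \<in> borel_measurable N" by (rule borel_measurable_LIMSEQ_real[OF assms(3,1)])
  then show "(\<lambda>y. p x y * g y) \<in> borel_measurable N"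
    using p_section_measurable by simp
  show "(\<lambda>y. p x y * G k y) \<in> borel_measurable N" for k
    using p_section_measurable assms(1) by simp
  show "AE y in N. (\<lambda>k. p x y * G k y) \<longlonglongrightarrow> p x y * g y"
    using assms(3) by (auto intro!: tendsto_mult_left)
  show "integrable N (\<lambda>y. C * B)" by simp
  show "AE y in N. norm (p x y * G k y) \<le> C * B" for k
  proof (rule AE_I2)
    fix y
    show "norm (p x y * G k y) \<le> C * B"
      using mult_mono[of "p x y" C "\<bar>G k y\<bar>" B] upper[of x y] assms(2)[of k y] p_pos[of x y] C_pos
      by (simp add: abs_mult)
  qed
qed

end

section \<open>Geometric convergence of the Sinkhorn iteration\<close>

context bounded_kernel
begin

interpretation swapped: bounded_kernel N M "\<lambda>y x. p x y" c C
  by (rule swap)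

text \<open>The inner inverse solves the first equation for \<open>f\<close> given \<open>g\<close>,
  the outer one solves the second equation for \<open>g\<close> given this \<open>f\<close>. At a
  fixed point both equations hold simultaneously.\<close>

definition sinkhorn :: "('b \<Rightarrow> real) \<Rightarrow> 'b \<Rightarrow> real" where
  "sinkhorn g = (\<lambda>y. inverse (swapped.K (\<lambda>x. inverse (K g x)) y))"

lemma bounded_away_sinkhorn: "bounded_away N g \<Longrightarrow> bounded_away N (sinkhorn g)"
  unfolding sinkhorn_def by (intro swapped.bounded_away_K bounded_away_K)

text \<open>Each half step exchanges the roles of \<open>g\<close> and \<open>g'\<close>, so two of
  them restore the order. One factor of contraction is kept; of the second half step only the
  inclusion of the new interval in the old one enters.\<close>

lemma sinkhorn_contraction:
  assumes g: "bounded_away N g" and g': "bounded_away N g'"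
    and ratio: "\<And>y. l * g y \<le> g' y" "\<And>y. g' y \<le> u * g y"
  obtains l' u' where "l \<le> l'" "u' \<le> u" "u' - l' \<le> (1 - c / C) * (u - l)"
    "\<And>y. l' * sinkhorn g y \<le> sinkhorn g' y" "\<And>y. sinkhorn g' y \<le> u' * sinkhorn g y"
proof -
  obtain l1 u1 where 1: "l \<le> l1" "u1 \<le> u" "u1 - l1 \<le> (1 - c / C) * (u - l)"
    "\<And>x. l1 * inverse (K g' x) \<le> inverse (K g x)" "\<And>x. inverse (K g x) \<le> u1 * inverse (K g' x)"
    using inverse_K_contraction[OF assms] by blast
  obtain l2 u2 where 2: "l1 \<le> l2" "u2 \<le> u1" "u2 - l2 \<le> (1 - c / C) * (u1 - l1)"
    "\<And>y. l2 * sinkhorn g y \<le> sinkhorn g' y" "\<And>y. sinkhorn g' y \<le> u2 * sinkhorn g y"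
    unfolding sinkhorn_def
    using swapped.inverse_K_contraction[OF bounded_away_K[OF g'] bounded_away_K[OF g] 1(4,5)] by blast
  show thesis
    by (rule that[of l2 u2]) (use 1 2 in auto)
qed

text \<open>Both \<open>g\<close> and \<open>sinkhorn g\<close> have integral \<open>1\<close> against the weight \<open>\<integral>x. p x y / K g x \<partial>M\<close>, so
  \<open>1\<close> lies between any bounds of their ratio.\<close>

lemma sinkhorn_ratio_one:
  assumes g: "bounded_away N g"
    and ratio: "\<And>y. l * g y \<le> sinkhorn g y" "\<And>y. sinkhorn g y \<le> u * g y"
  shows "l \<le> 1" "1 \<le> u"
proof -
  let ?f = "\<lambda>x. inverse (K g x)"
  have f: "bounded_away M ?f" by (rule bounded_away_K[OF g])
  note s = bounded_away_sinkhorn[OF g]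
  have Kpos: "0 < K g x" "0 < swapped.K ?f y" for x y
    using bounded_away_pos[OF f, of x] bounded_away_pos[OF s, of y] unfolding sinkhorn_def by simp_all
  have [measurable]: "g \<in> borel_measurable N" "?f \<in> borel_measurable M"
    using f g unfolding bounded_away_def by auto
  obtain a b where ab: "\<And>x. ?f x \<le> a" "\<And>y. g y \<le> b"
    using f g unfolding bounded_away_def by blast
  have int: "integrable (M \<Otimes>\<^sub>M N) (\<lambda>(x, y). ?f x * p x y * g y)"
  proof (rule P.integrable_const_bound[of _ "a * C * b"])
    have "norm (?f x * p x y * g y) \<le> a * C * b" for x y
    proof -
      have "?f x * p x y * g y \<le> a * C * b"
        using bounded_away_pos[OF f, of x] p_pos[of x y] bounded_away_pos[OF g, of y] C_pos
          ab(1)[of x] ab(2)[of y] upper[of x y]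
        by (intro mult_mono mult_nonneg_nonneg) linarith+
      then show ?thesis
        using bounded_away_pos[OF f, of x] p_pos[of x y] bounded_away_pos[OF g, of y]
        by (simp add: abs_mult abs_of_pos)
    qed
    then show "AE z in M \<Otimes>\<^sub>M N. norm (case z of (x, y) \<Rightarrow> ?f x * p x y * g y) \<le> a * C * b"
      by auto
  qed (use p_measurable in \<open>simp add: case_prod_beta'\<close>)
  have "1 = (\<integral>x. ?f x * K g x \<partial>M)"
    using Kpos(1) by (simp add: less_imp_neq[symmetric] M.prob_space)
  also have "\<dots> = (\<integral>x. \<integral>y. ?f x * p x y * g y \<partial>N \<partial>M)"
    by (simp add: K_def mult.assoc)
  also have "\<dots> = (\<integral>y. \<integral>x. ?f x * p x y * g y \<partial>M \<partial>N)"
    using Fubini_integral[OF int] by simp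
  also have "\<dots> = (\<integral>y. g y * swapped.K ?f y \<partial>N)"
  proof (rule Bochner_Integration.integral_cong[OF refl])
    fix y
    show "(\<integral>x. ?f x * p x y * g y \<partial>M) = g y * swapped.K ?f y"
      unfolding swapped.K_def integral_mult_right_zero[symmetric]
      by (intro Bochner_Integration.integral_cong) simp_all
  qed
  finally have one: "(\<integral>y. g y * swapped.K ?f y \<partial>N) = 1" by simp
  \<comment> \<open>The Bochner integral of a non-integrable function is 0, so the value 1 already
    implies integrability.\<close>
  have intg: "integrable N (\<lambda>y. g y * swapped.K ?f y)"
    using one not_integrable_integral_eq by fastforce
  have s_one: "sinkhorn g y * swapped.K ?f y = 1" for y
    unfolding sinkhorn_def using Kpos(2)[of y] by simp
  have bounds: "l * (g y * swapped.K ?f y) \<le> 1" "1 \<le> u * (g y * swapped.K ?f y)" for y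
    using mult_right_mono[OF ratio(1) less_imp_le[OF Kpos(2)], of y y]
      mult_right_mono[OF ratio(2) less_imp_le[OF Kpos(2)], of y y] s_one[of y]
    by (simp_all add: mult.assoc)
  have "(\<integral>y. l * (g y * swapped.K ?f y) \<partial>N) \<le> (\<integral>y. 1 \<partial>N)"
    using intg bounds by (intro integral_mono) simp_all
  then show "l \<le> 1" using one by (simp add: N.prob_space)
  have "(\<integral>y. 1 \<partial>N) \<le> (\<integral>y. u * (g y * swapped.K ?f y) \<partial>N)"
    using intg bounds by (intro integral_mono) simp_all
  then show "1 \<le> u" using one by (simp add: N.prob_space)
qed

text \<open>Contraction alone only shows that the ratio of consecutive iterates becomes constant. By
  \<open>sinkhorn_ratio_one\<close> this constant is 1, so without any renormalisation the
  increments of \<open>ln (G k y)\<close> are summable uniformly in \<open>y\<close>; the limit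
  stays bounded away from zero and is a fixed point.\<close>

lemma schroedinger_factors_exist:
  obtains f g where "bounded_away M f" "bounded_away N g"
    "\<And>x. f x * (\<integral>y. p x y * g y \<partial>N) = 1" "\<And>y. g y * (\<integral>x. p x y * f x \<partial>M) = 1"
proof -
  define G where "G k = (sinkhorn ^^ k) (\<lambda>_. 1)" for k
  have G_Suc: "G (Suc k) = sinkhorn (G k)" for k unfolding G_def by simp
  have G: "bounded_away N (G k)" for k
  proof (induction k)
    case 0
    show ?case unfolding G_def bounded_away_def by (auto intro!: exI[of _ 1])
  qed (simp add: G_Suc bounded_away_sinkhorn)
  note Gpos = bounded_away_pos[OF G]
  define q where "q = 1 - c / C"
  have q: "0 \<le> q" "q < 1" unfolding q_def using c_pos C_pos c_le_C by simp_all
  \<comment> \<open>Since \<open>G 0\<close> is constantly 1, bounds for \<open>G 1\<close> are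
    bounds for the first ratio.\<close>
  obtain l0 u0 where l0: "0 < l0" "\<And>y. l0 \<le> G 1 y" "\<And>y. G 1 y \<le> u0"
    using G[of 1] unfolding bounded_away_def by blast
  have ex: "\<exists>l u. l0 \<le> l \<and> u - l \<le> q ^ k * (u0 - l0) \<and>
      (\<forall>y. l * G k y \<le> G (Suc k) y \<and> G (Suc k) y \<le> u * G k y)" for k
  proof (induction k)
    case 0
    show ?case using l0 by (intro exI[of _ l0] exI[of _ u0]) (simp add: G_def)
  next
    case (Suc k)
    then obtain l u where lu: "l0 \<le> l" "u - l \<le> q ^ k * (u0 - l0)"
      "\<And>y. l * G k y \<le> G (Suc k) y" "\<And>y. G (Suc k) y \<le> u * G k y" by blast
    obtain l' u' where *: "l \<le> l'" "u' \<le> u" "u' - l' \<le> q * (u - l)"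
      "\<And>y. l' * G (Suc k) y \<le> G (Suc (Suc k)) y" "\<And>y. G (Suc (Suc k)) y \<le> u' * G (Suc k) y"
      unfolding q_def using sinkhorn_contraction[OF G G lu(3,4)] unfolding G_Suc[symmetric] by blast
    have "u' - l' \<le> q ^ Suc k * (u0 - l0)"
      using *(3) mult_left_mono[OF lu(2) q(1)] by simp
    with * lu(1) show ?case by (intro exI[of _ l'] exI[of _ u']) auto
  qed
  \<comment> \<open>The ratio r of consecutive iterates and the number 1 both lie between l and u.
    The first summand covers ln r \<le> r - 1 \<le> u - l; the second covers - ln r \<le> (1 - l) /
    l \<le> (u - l) / \<open>l0\<close>.\<close>
  define E where "E = (u0 - l0) + (u0 - l0) / l0"
  have step: "\<bar>ln (G (Suc k) y) - ln (G k y)\<bar> \<le> E * q ^ k" for k y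
  proof -
    obtain l u where lu: "l0 \<le> l" "u - l \<le> q ^ k * (u0 - l0)"
      "\<And>y. l * G k y \<le> G (Suc k) y" "\<And>y. G (Suc k) y \<le> u * G k y" using ex[of k] by blast
    have one: "l \<le> 1" "1 \<le> u"
      using sinkhorn_ratio_one[OF G[of k]] lu(3,4) unfolding G_Suc by blast+
    have l: "0 < l" using lu(1) l0(1) by simp
    let ?r = "G (Suc k) y / G k y"
    have r: "l \<le> ?r" "?r \<le> u" "0 < ?r"
      using lu(3,4)[of y] Gpos[of k y] Gpos[of "Suc k" y] by (simp_all add: field_simps)
    have eq: "ln (G (Suc k) y) - ln (G k y) = ln ?r"
      using Gpos[of k y] Gpos[of "Suc k" y] by (simp add: ln_div)
    define X where "X = q ^ k * (u0 - l0)"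
    have X: "0 \<le> X" using lu(2) one unfolding X_def by simp
    have E: "E * q ^ k = X + X / l0"
      unfolding E_def X_def distrib_right times_divide_eq_left mult.commute[of "q ^ k"] ..
    have X': "0 \<le> X / l0" using X l0(1) by simp
    have "ln ?r \<le> ?r - 1" using r(3) by (rule ln_le_minus_one)
    also have "\<dots> \<le> X" using r one lu(2) unfolding X_def by simp
    also have "\<dots> \<le> E * q ^ k" using E X' by simp
    finally have 1: "ln ?r \<le> E * q ^ k" .
    have "- ln ?r \<le> inverse ?r - 1"
      using ln_le_minus_one[of "inverse ?r"] r(3) by (simp add: ln_inverse del: inverse_divide)
    also have "\<dots> \<le> inverse l - 1" using r(1) l by (simp add: le_imp_inverse_le del: inverse_divide)
    also have "\<dots> = (1 - l) / l" using l by (simp add: field_simps)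
    also have "\<dots> \<le> X / l0"
      using one lu l0(1) X unfolding X_def by (intro frac_le) linarith+
    also have "\<dots> \<le> E * q ^ k" using E X by simp
    finally show ?thesis unfolding eq using 1 by (simp add: abs_le_iff)
  qed
  define d where "d k y = ln (G (Suc k) y) - ln (G k y)" for k y
  have summ_q: "summable (\<lambda>k. E * q ^ k)" using q by (intro summable_mult summable_geometric) simp
  have summ_d: "summable (\<lambda>k. d k y)" for y
    by (rule summable_comparison_test'[OF summ_q]) (simp add: d_def step)
  have lnG: "ln (G k y) = (\<Sum>j<k. d j y)" for k y
    by (induction k) (simp_all add: d_def, simp add: G_def)
  define B where "B = (\<Sum>k. E * q ^ k)"
  \<comment> \<open>Any point of the type will do here: the expression bounds an absolute
    value.\<close>
  have "0 \<le> E * q ^ k" for k using step[of k undefined] by (meson abs_ge_zero order_trans)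
  then have lnG_bound: "\<bar>ln (G k y)\<bar> \<le> B" for k y
  proof -
    have "\<bar>ln (G k y)\<bar> \<le> (\<Sum>j<k. \<bar>d j y\<bar>)" unfolding lnG by (rule sum_abs)
    also have "\<dots> \<le> (\<Sum>j<k. E * q ^ j)" by (intro sum_mono) (simp add: d_def step)
    also have "\<dots> \<le> B"
      unfolding B_def using \<open>\<And>k. 0 \<le> E * q ^ k\<close> by (intro sum_le_suminf[OF summ_q]) auto
    finally show ?thesis .
  qed
  then have G_bounds: "exp (- B) \<le> G k y" "G k y \<le> exp B" for k y
  proof -
    have "- B \<le> ln (G k y)" "ln (G k y) \<le> B" using lnG_bound[of k y] by (simp_all add: abs_le_iff)
    then show "exp (- B) \<le> G k y" "G k y \<le> exp B"
      using Gpos[of k y] by (metis exp_le_cancel_iff exp_ln)+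
  qed
  define g where "g y = exp (\<Sum>k. d k y)" for y
  have G_lim: "(\<lambda>k. G k y) \<longlonglongrightarrow> g y" for y
  proof -
    have "(\<lambda>k. exp (ln (G k y))) \<longlonglongrightarrow> g y"
      unfolding lnG g_def by (intro tendsto_exp summable_LIMSEQ summ_d)
    then show ?thesis using Gpos by simp
  qed
  have G_meas: "G k \<in> borel_measurable N" for k using G[of k] unfolding bounded_away_def by simp
  have "g \<in> borel_measurable N" by (rule borel_measurable_LIMSEQ_real[OF G_lim G_meas])
  moreover have "exp (- B) \<le> g y" "g y \<le> exp B" for y
    using LIMSEQ_le_const[OF G_lim] LIMSEQ_le_const2[OF G_lim] G_bounds by blast+
  ultimately have g: "bounded_away N g"
    unfolding bounded_away_def using exp_gt_zero by blast
  define f where "f x = inverse (K g x)" for x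
  have f: "bounded_away M f" unfolding f_def by (rule bounded_away_K[OF g])
  have Kg_pos: "0 < K g x" for x using bounded_away_pos[OF f, of x] unfolding f_def by simp
  have K_lim: "(\<lambda>k. K (G k) x) \<longlonglongrightarrow> K g x" for x
    by (rule K_tendsto[of _ "exp B"])
      (use G_lim G_meas G_bounds Gpos in \<open>auto simp: abs_of_pos\<close>)
  define F where "F k x = inverse (K (G k) x)" for k x
  have F_lim: "(\<lambda>k. F k x) \<longlonglongrightarrow> f x" for x
    unfolding F_def f_def using Kg_pos[of x] by (intro tendsto_inverse K_lim) simp
  have F: "bounded_away M (F k)" for k unfolding F_def by (rule bounded_away_K[OF G])
  \<comment> \<open>Uniformity in \<open>k\<close> bounds all \<open>F k\<close> by one constant, as
    dominated convergence in the second half step requires.\<close>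
  have "c * exp (- B) \<le> K (G k) x" for k x
  proof -
    have "exp (- B) \<le> (\<integral>y. G k y \<partial>N)"
      using G_bounds N.bounded_away_integrable[OF G] by (intro N.integral_ge_const) auto
    then have "c * exp (- B) \<le> c * (\<integral>y. G k y \<partial>N)" using c_pos by simp
    also have "\<dots> \<le> K (G k) x"
      by (rule K_bounds[OF N.bounded_away_integrable[OF G] less_imp_le[OF Gpos]])
    finally show ?thesis .
  qed
  then have "F k x \<le> inverse (c * exp (- B))" for k x
    unfolding F_def using c_pos by (intro le_imp_inverse_le) auto
  then have "(\<lambda>k. swapped.K (F k) y) \<longlonglongrightarrow> swapped.K f y" for y
    by (intro swapped.K_tendsto[of _ "inverse (c * exp (- B))"])
      (use F_lim F bounded_away_pos[OF F] in \<open>auto simp: abs_of_pos bounded_away_def\<close>)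
  moreover have Kf_pos: "0 < swapped.K f y" for y
    using bounded_away_pos[OF swapped.bounded_away_K[OF f], of y] by simp
  ultimately have "(\<lambda>k. inverse (swapped.K (F k) y)) \<longlonglongrightarrow> inverse (swapped.K f y)" for y
    by (intro tendsto_inverse) (auto simp: less_imp_neq[symmetric])
  \<comment> \<open>The image of \<open>G k\<close> is the next iterate, which has the same limit;
    hence \<open>g\<close> is a fixed point.\<close>
  moreover have "(\<lambda>k. inverse (swapped.K (F k) y)) = (\<lambda>k. G (Suc k) y)" for y
    unfolding G_Suc sinkhorn_def F_def ..
  ultimately have "inverse (swapped.K f y) = g y" for y
    using LIMSEQ_Suc[OF G_lim[of y]] LIMSEQ_unique by metis
  then have "g y * swapped.K f y = 1" for y
    using Kf_pos[of y] by (metis left_inverse less_irrefl)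
  moreover have "f x * K g x = 1" for x
    unfolding f_def using Kg_pos[of x] by simp
  ultimately show thesis
    by (intro that[OF f g]) (auto simp: K_def swapped.K_def)
qed

end

section \<open>Passage to the limit\<close>

text \<open>Division by \<open>F\<close> leads to functions between 0 and 1. Since \<open>F\<close>
  may be neither bounded nor integrable, the test functions are those whose product with
  \<open>F\<close> is bounded, hence integrable for the finite measure.\<close>

lemma dominated_functions_weak_compact:
  fixes M :: "'a::second_countable_topology measure" and f :: "nat \<Rightarrow> 'a \<Rightarrow> real"
  assumes "finite_measure M" and M: "sets M = sets borel"
    and [measurable]: "\<And>n. f n \<in> borel_measurable M" "F \<in> borel_measurable M"
    and F: "\<And>x. 0 < F x" and f: "\<And>n x. 0 \<le> f n x" "\<And>n x. f n x \<le> F x"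
  obtains r f' where "strict_mono (r :: nat \<Rightarrow> nat)" "f' \<in> borel_measurable M"
    "\<And>x. 0 \<le> f' x" "\<And>x. f' x \<le> F x"
    "\<And>\<psi> b. \<psi> \<in> borel_measurable M \<Longrightarrow> (\<And>x. \<bar>F x * \<psi> x\<bar> \<le> b) \<Longrightarrow>
      (\<lambda>n. \<integral>x. f (r n) x * \<psi> x \<partial>M) \<longlonglongrightarrow> (\<integral>x. f' x * (\<psi> x :: real) \<partial>M)"
proof -
  interpret finite_measure M by fact
  have nz: "F x \<noteq> 0" for x using F[of x] by simp
  obtain r h where r: "strict_mono (r :: nat \<Rightarrow> nat)" and [measurable]: "h \<in> borel_measurable M"
    and h: "\<And>x. 0 \<le> h x" "\<And>x. h x \<le> 1"
    and lim: "\<And>\<psi>. integrable M \<psi> \<Longrightarrow>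
      (\<lambda>n. \<integral>x. f (r n) x / F x * \<psi> x \<partial>M) \<longlonglongrightarrow> (\<integral>x. h x * (\<psi> x :: real) \<partial>M)"
  proof (rule bounded_functions_weak_compact[of M "\<lambda>n x. f n x / F x"])
    show "0 \<le> f n x / F x" "f n x / F x \<le> 1" for n x
      using f[where n=n and x=x] F[of x] by simp_all
  qed (use assms in auto)
  show thesis
  proof (rule that[of r "\<lambda>x. h x * F x"])
    show "0 \<le> h x * F x" "h x * F x \<le> F x" for x
      using h[of x] F[of x] by (simp_all add: mult_left_le_one_le)
    fix \<psi> :: "'a \<Rightarrow> real" and b
    assume [measurable]: "\<psi> \<in> borel_measurable M" and b: "\<And>x. \<bar>F x * \<psi> x\<bar> \<le> b"
    have "integrable M (\<lambda>x. F x * \<psi> x)"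
      using b by (intro integrable_const_bound[of _ b]) auto
    from lim[OF this] show "(\<lambda>n. \<integral>x. f (r n) x * \<psi> x \<partial>M) \<longlonglongrightarrow> (\<integral>x. h x * F x * \<psi> x \<partial>M)"
      by (simp add: nz mult.assoc)
  qed (use r in simp_all)
qed

section \<open>Mass of a coupling on rectangles\<close>

context bounded_kernel
begin

text \<open>With \<open>f x * p x y * g y\<close> as the density of a coupling, \<open>q\<close> is
  the mass of A x D. It can miss at most \<open>measure N (- D)\<close> of the mass over
  \<open>A\<close>, because the second marginal is \<open>N\<close>. The iterated form of
  \<open>q\<close>, with an inner function of \<open>x\<close>, is the one to which the weak limits
  apply.\<close>

lemma coupling_bounds:
  assumes f: "bounded_away M f" and g: "bounded_away N g"
    and fM: "\<And>x. f x * (\<integral>y. p x y * g y \<partial>N) = 1" and gN: "\<And>y. g y * (\<integral>x. p x y * f x \<partial>M) = 1"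
    and [measurable]: "A \<in> sets M" "D \<in> sets N"
  defines "q \<equiv> \<integral>x. f x * (indicator A x * (\<integral>y. g y * (indicator D y * p x y) \<partial>N)) \<partial>M"
  shows "measure M A - measure N (- D) \<le> q" "q \<le> measure M A"
proof -
  let ?P = "M \<Otimes>\<^sub>M N"
  have [measurable]: "f \<in> borel_measurable M" "g \<in> borel_measurable N"
    using f g unfolding bounded_away_def by auto
  have [measurable]: "- D \<in> sets N"
    using sets.compl_sets[of D N] by (simp add: space_N Compl_eq_Diff_UNIV)
  define w where "w z = f (fst z) * p (fst z) (snd z) * g (snd z)" for z
  have w_meas[measurable]: "w \<in> borel_measurable ?P"
    unfolding w_def using p_measurable by (simp add: case_prod_beta')
  have w_pos: "0 < w z" for z
    unfolding w_def using bounded_away_pos[OF f] bounded_away_pos[OF g] p_pos by simp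
  obtain a b where ab: "\<And>x. f x \<le> a" "\<And>y. g y \<le> b"
    using f g unfolding bounded_away_def by blast
  have w_le: "w z \<le> a * C * b" for z
    unfolding w_def
    using bounded_away_pos[OF f, of "fst z"] p_pos[of "fst z" "snd z"] bounded_away_pos[OF g, of "snd z"] C_pos
      ab(1)[of "fst z"] ab(2)[of "snd z"] upper[of "fst z" "snd z"]
    by (intro mult_mono mult_nonneg_nonneg) linarith+
  have int: "integrable ?P (\<lambda>z. w z * k z)" if "k \<in> borel_measurable ?P" "\<And>z. 0 \<le> k z" "\<And>z. k z \<le> 1" for k
  proof (rule P.integrable_const_bound[of _ "a * C * b"])
    have "norm (w z * k z) \<le> w z" for z
      using w_pos[of z] that(2,3)[of z] by (simp add: abs_mult mult_right_le_one_le)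
    then show "AE z in ?P. norm (w z * k z) \<le> a * C * b"
      using w_le order_trans by (intro AE_I2) blast
  qed (use that in simp)
  have w_M: "(\<integral>y. w (x, y) \<partial>N) = 1" for x
    using fM[of x] unfolding w_def by (simp add: mult.assoc)
  have w_N: "(\<integral>x. w (x, y) \<partial>M) = 1" for y
    using gN[of y] unfolding w_def by (simp add: mult_ac flip: integral_mult_right_zero)
  have 1: "(\<integral>z. w z * indicator A (fst z) \<partial>?P) = measure M A"
  proof -
    have "(\<integral>z. w z * indicator A (fst z) \<partial>?P) = (\<integral>x. \<integral>y. w (x, y) * indicator A x \<partial>N \<partial>M)"
      using integral_fst'[OF int[of "\<lambda>z. indicator A (fst z)"]] by simp
    then show ?thesis by (simp add: w_M)
  qed
  have 2: "(\<integral>z. w z * indicator (- D) (snd z) \<partial>?P) = measure N (- D)"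
  proof -
    have "(\<integral>z. w z * indicator (- D) (snd z) \<partial>?P) = (\<integral>y. \<integral>x. w (x, y) * indicator (- D) y \<partial>M \<partial>N)"
      using integral_snd[of "\<lambda>x y. w (x, y) * indicator (- D) y"] int[of "\<lambda>z. indicator (- D) (snd z)"]
      by (simp add: case_prod_beta')
    then show ?thesis by (simp add: w_N)
  qed
  have 3: "(\<integral>z. w z * (indicator A (fst z) * indicator D (snd z)) \<partial>?P) = q"
  proof -
    have "(\<integral>z. w z * (indicator A (fst z) * indicator D (snd z)) \<partial>?P)
        = (\<integral>x. \<integral>y. w (x, y) * (indicator A x * indicator D y) \<partial>N \<partial>M)"
      using integral_fst'[OF int[of "\<lambda>z. indicator A (fst z) * indicator D (snd z)"]]
      by (simp add: indicator_def)
    also have "\<dots> = q"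
      unfolding q_def w_def integral_mult_right_zero[symmetric]
      by (intro Bochner_Integration.integral_cong) simp_all
    finally show ?thesis .
  qed
  \<comment> \<open>Pointwise, the indicator of \<open>A\<close> minus that of \<open>- D\<close> is
    at most the product of the indicators of \<open>A\<close> and \<open>D\<close>.\<close>
  have "(\<integral>z. w z * indicator A (fst z) - w z * indicator (- D) (snd z) \<partial>?P) \<le> q"
    unfolding 3[symmetric] using w_pos
    by (intro integral_mono Bochner_Integration.integrable_diff int) (auto simp: indicator_def less_imp_le)
  then show "measure M A - measure N (- D) \<le> q"
    using int[of "\<lambda>z. indicator A (fst z)"] int[of "\<lambda>z. indicator (- D) (snd z)"]
    by (subst (asm) Bochner_Integration.integral_diff) (auto simp: 1 2)
  show "q \<le> measure M A"
    unfolding 3[symmetric] 1[symmetric] using w_pos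
    by (intro integral_mono int) (auto simp: indicator_def less_imp_le)
qed

end

text \<open>Collects what the limit argument uses about the approximations: majorants, weak limits,
  and the mass bounds on rectangles, which are all that is kept of the two equations. One instance
  yields the first equation of the system, the transposed instance the second.\<close>

locale coupling_limit = M: prob_space M + N: prob_space N
  for M :: "'a measure" and N :: "'b measure" +
  fixes p :: "'a \<Rightarrow> 'b \<Rightarrow> real" and C :: real and \<epsilon> :: "nat \<Rightarrow> real"
    and f :: "nat \<Rightarrow> 'a \<Rightarrow> real" and f' F :: "'a \<Rightarrow> real"
    and g :: "nat \<Rightarrow> 'b \<Rightarrow> real" and g' G :: "'b \<Rightarrow> real"
  assumes p[measurable]: "case_prod p \<in> borel_measurable (M \<Otimes>\<^sub>M N)"
    and sp: "space M = UNIV" "space N = UNIV"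
    and p_bounds: "\<And>x y. 0 < p x y" "\<And>x y. p x y \<le> C"
    and \<epsilon>: "\<epsilon> \<longlonglongrightarrow> 0" "\<And>n. 0 \<le> \<epsilon> n" "\<And>n. \<epsilon> n \<le> 1"
    and fn[measurable]: "\<And>n. f n \<in> borel_measurable M" and f'[measurable]: "f' \<in> borel_measurable M"
    and gn[measurable]: "\<And>n. g n \<in> borel_measurable N" and g'[measurable]: "g' \<in> borel_measurable N"
    and F_meas[measurable]: "F \<in> borel_measurable M" and G_meas[measurable]: "G \<in> borel_measurable N"
    and F: "\<And>n x. 0 \<le> f n x" "\<And>n x. f n x \<le> F x" "\<And>x. 0 \<le> f' x" "\<And>x. f' x \<le> F x"
    and G: "\<And>n y. 0 \<le> g n y" "\<And>n y. g n y \<le> G y" "\<And>y. 0 \<le> g' y" "\<And>y. g' y \<le> G y"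
    and f_lim: "\<And>\<psi> b. \<psi> \<in> borel_measurable M \<Longrightarrow> (\<And>x. \<bar>F x * \<psi> x\<bar> \<le> b) \<Longrightarrow>
      (\<lambda>n. \<integral>x. f n x * \<psi> x \<partial>M) \<longlonglongrightarrow> (\<integral>x. f' x * (\<psi> x :: real) \<partial>M)"
    and g_lim: "\<And>\<psi> b. \<psi> \<in> borel_measurable N \<Longrightarrow> (\<And>y. \<bar>G y * \<psi> y\<bar> \<le> b) \<Longrightarrow>
      (\<lambda>n. \<integral>y. g n y * \<psi> y \<partial>N) \<longlonglongrightarrow> (\<integral>y. g' y * (\<psi> y :: real) \<partial>N)"
    and coupling: "\<And>n A D. A \<in> sets M \<Longrightarrow> D \<in> sets N \<Longrightarrow>
        measure M A - measure N (- D)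
          \<le> (\<integral>x. f n x * (indicator A x * (\<integral>y. g n y * (indicator D y * (p x y + \<epsilon> n)) \<partial>N)) \<partial>M)"
      "\<And>n A D. A \<in> sets M \<Longrightarrow> D \<in> sets N \<Longrightarrow>
        (\<integral>x. f n x * (indicator A x * (\<integral>y. g n y * (indicator D y * (p x y + \<epsilon> n)) \<partial>N)) \<partial>M)
          \<le> measure M A"
begin

lemma C_pos: "0 < C"
  using p_bounds[of undefined undefined] by simp

lemma p_sec[measurable]: "(\<lambda>y. p x y) \<in> borel_measurable N"
  using measurable_compose[OF measurable_Pair1' p, of x] by (simp add: sp)

text \<open>On \<open>D\<close> the functions \<open>g n\<close> are bounded, so for each fixed
  \<open>x\<close> the kernel is an admissible test function and the inner integrals converge
  pointwise. They are bounded by \<open>t * (C + 1)\<close>, since \<open>p \<le> C\<close> and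
  \<open>\<epsilon> n \<le> 1\<close>; dominated convergence replaces them by their limit, which is
  then a fixed test function for the weak convergence of \<open>f n\<close>.\<close>

lemma truncated_coupling_limit:
  assumes [measurable]: "A \<in> sets M" "D \<in> sets N"
    and A: "\<And>x. x \<in> A \<Longrightarrow> F x \<le> t" and D: "\<And>y. y \<in> D \<Longrightarrow> G y \<le> t" and t: "0 \<le> t"
  shows "(\<lambda>n. \<integral>x. f n x * (indicator A x * (\<integral>y. g n y * (indicator D y * (p x y + \<epsilon> n)) \<partial>N)) \<partial>M)
    \<longlonglongrightarrow> (\<integral>x. f' x * (indicator A x * (\<integral>y. g' y * (indicator D y * p x y) \<partial>N)) \<partial>M)"
proof -
  note C = C_pos
  define \<phi> where "\<phi> x = (\<integral>y. g' y * (indicator D y * p x y) \<partial>N)" for x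
  define \<phi>n where "\<phi>n n x = (\<integral>y. g n y * (indicator D y * (p x y + \<epsilon> n)) \<partial>N)" for n x
  have [measurable]: "\<phi> \<in> borel_measurable M" "\<And>n. \<phi>n n \<in> borel_measurable M"
    unfolding \<phi>_def[abs_def] \<phi>n_def[abs_def]
    by (rule N.borel_measurable_lebesgue_integral, use p in \<open>simp add: case_prod_beta'\<close>)+
  have gD: "0 \<le> g n y * indicator D y" "g n y * indicator D y \<le> t"
    "0 \<le> g' y * indicator D y" "g' y * indicator D y \<le> t" for n y
    using G(1,2)[of n y] G(3,4)[of y] D[of y] t by (auto simp: indicator_def)
  have fA: "0 \<le> f n x * indicator A x" "f n x * indicator A x \<le> t" for n x
    using F(1,2)[of n x] A[of x] t by (auto simp: indicator_def)
  have integrand: "\<bar>a * (k * c)\<bar> \<le> t * (C + 1)"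
    if "0 \<le> a * k" "a * k \<le> t" "0 \<le> c" "c \<le> C + 1" for a k c :: real
    using mult_mono[OF that(2,4) t that(3)]
    unfolding mult.assoc[symmetric] abs_of_nonneg[OF mult_nonneg_nonneg[OF that(1,3)]] .
  have int_gn: "integrable N (\<lambda>y. g n y * (indicator D y * (p x y + \<epsilon> n)))"
      and \<phi>n_le: "\<bar>\<phi>n n x\<bar> \<le> t * (C + 1)" for n x
  proof -
    have b: "\<bar>g n y * (indicator D y * (p x y + \<epsilon> n))\<bar> \<le> t * (C + 1)" for y
      using gD p_bounds[of x y] \<epsilon>(2,3)[of n] by (intro integrand) auto
    show int: "integrable N (\<lambda>y. g n y * (indicator D y * (p x y + \<epsilon> n)))"
      using b by (intro N.integrable_const_bound[of _ "t * (C + 1)"]) auto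
    have "\<bar>\<phi>n n x\<bar> \<le> (\<integral>y. \<bar>g n y * (indicator D y * (p x y + \<epsilon> n))\<bar> \<partial>N)"
      unfolding \<phi>n_def by (rule integral_abs_bound)
    also have "\<dots> \<le> t * (C + 1)"
      using int b by (intro N.integral_le_const integrable_abs) auto
    finally show "\<bar>\<phi>n n x\<bar> \<le> t * (C + 1)" .
  qed
  have \<phi>_lim: "(\<lambda>n. \<phi>n n x) \<longlonglongrightarrow> \<phi> x" for x
  proof -
    have bD: "\<bar>G y * (indicator D y * p x y)\<bar> \<le> t * C" "\<bar>G y * indicator D y\<bar> \<le> t" for y
    proof -
      have "0 \<le> G y" using G(3,4)[of y] by simp
      then show "\<bar>G y * (indicator D y * p x y)\<bar> \<le> t * C" "\<bar>G y * indicator D y\<bar> \<le> t"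
        using D[of y] p_bounds[of x y] t C
        by (auto simp: indicator_def abs_mult intro!: mult_mono)
    qed
    have l1: "(\<lambda>n. \<integral>y. g n y * (indicator D y * p x y) \<partial>N) \<longlonglongrightarrow> \<phi> x"
      unfolding \<phi>_def using bD(1) by (intro g_lim) auto
    have l2: "(\<lambda>n. \<integral>y. g n y * indicator D y \<partial>N) \<longlonglongrightarrow> (\<integral>y. g' y * indicator D y \<partial>N)"
      using bD(2) by (intro g_lim) auto
    \<comment> \<open>The perturbation contributes \<open>\<epsilon> n\<close> times the mass on
      \<open>D\<close>. This mass converges, so the contribution vanishes.\<close>
    have "\<phi>n n x = (\<integral>y. g n y * (indicator D y * p x y) \<partial>N) + \<epsilon> n * (\<integral>y. g n y * indicator D y \<partial>N)" for n
    proof -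
      have i: "integrable N (\<lambda>y. g n y * indicator D y)"
        using gD(1,2)[of n] by (intro N.integrable_const_bound[of _ t]) auto
      have "integrable N (\<lambda>y. g n y * (indicator D y * (p x y + \<epsilon> n)) - \<epsilon> n * (g n y * indicator D y))"
        using int_gn i by simp
      then have "integrable N (\<lambda>y. g n y * (indicator D y * p x y))"
        by (simp add: algebra_simps)
      with i show ?thesis
        unfolding \<phi>n_def integral_mult_right_zero[symmetric]
        by (subst Bochner_Integration.integral_add[symmetric]) (auto simp: algebra_simps)
    qed
    then show ?thesis
      using tendsto_add[OF l1 tendsto_mult[OF \<epsilon>(1) l2]] by simp
  qed
  have \<phi>_le: "\<bar>\<phi> x\<bar> \<le> t * (C + 1)" for x
    by (rule LIMSEQ_le_const2[OF tendsto_rabs[OF \<phi>_lim]]) (use \<phi>n_le in auto)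
  have l1: "(\<lambda>n. \<integral>x. f n x * (indicator A x * \<phi> x) \<partial>M) \<longlonglongrightarrow> (\<integral>x. f' x * (indicator A x * \<phi> x) \<partial>M)"
  proof (rule f_lim)
    show "\<bar>F x * (indicator A x * \<phi> x)\<bar> \<le> t * (t * (C + 1))" for x
    proof -
      have "0 \<le> F x" using F(3,4)[of x] by simp
      then show ?thesis
        using A[of x] \<phi>_le[of x] t C by (auto simp: indicator_def abs_mult intro!: mult_mono)
    qed
  qed measurable
  have dom: "(\<lambda>n. \<integral>x. f n x * (indicator A x * (\<phi>n n x - \<phi> x)) \<partial>M) \<longlonglongrightarrow> (\<integral>x. 0 \<partial>M)"
  proof (rule integral_dominated_convergence)
    show "integrable M (\<lambda>x. t * (2 * (t * (C + 1))))" by simp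
    have d: "\<bar>f n x * (indicator A x * (\<phi>n n x - \<phi> x))\<bar> \<le> t * \<bar>\<phi>n n x - \<phi> x\<bar>" for n x
      using fA[of n x] mult_right_mono[OF fA(2)[of n x], of "\<bar>\<phi>n n x - \<phi> x\<bar>"]
      by (simp add: abs_mult mult.assoc[symmetric] F)
    have "\<bar>\<phi>n n x - \<phi> x\<bar> \<le> 2 * (t * (C + 1))" for n x
      using \<phi>n_le[of n x] \<phi>_le[of x] by linarith
    then show "AE x in M. norm (f n x * (indicator A x * (\<phi>n n x - \<phi> x))) \<le> t * (2 * (t * (C + 1)))" for n
      unfolding real_norm_def by (intro AE_I2 order_trans[OF d] mult_left_mono t)
    have "(\<lambda>n. f n x * (indicator A x * (\<phi>n n x - \<phi> x))) \<longlonglongrightarrow> 0" for x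
    proof (rule Lim_null_comparison)
      show "\<forall>\<^sub>F n in sequentially. norm (f n x * (indicator A x * (\<phi>n n x - \<phi> x))) \<le> t * \<bar>\<phi>n n x - \<phi> x\<bar>"
        using d by simp
      have "(\<lambda>n. t * \<bar>\<phi>n n x - \<phi> x\<bar>) \<longlonglongrightarrow> t * 0"
        by (intro tendsto_mult_left tendsto_rabs_zero LIM_zero \<phi>_lim)
      then show "(\<lambda>n. t * \<bar>\<phi>n n x - \<phi> x\<bar>) \<longlonglongrightarrow> 0" by simp
    qed
    then show "AE x in M. (\<lambda>n. f n x * (indicator A x * (\<phi>n n x - \<phi> x))) \<longlonglongrightarrow> 0" by simp
  qed simp_all
  have int_f: "integrable M (\<lambda>x. f n x * (indicator A x * k x))"
    if [measurable]: "k \<in> borel_measurable M" and "\<And>x. \<bar>k x\<bar> \<le> t * (C + 1)" for n k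
  proof (rule M.integrable_const_bound[of _ "t * (t * (C + 1))"])
    have "\<bar>f n x * (indicator A x * k x)\<bar> \<le> t * (t * (C + 1))" for x
      using mult_mono[OF fA(2)[of n x] that(2)[of x] t abs_ge_zero] fA(1)[of n x]
      by (simp add: abs_mult mult.assoc[symmetric] F)
    then show "AE x in M. norm (f n x * (indicator A x * k x)) \<le> t * (t * (C + 1))" by simp
  qed measurable
  have "(\<integral>x. f n x * (indicator A x * \<phi>n n x) \<partial>M)
      = (\<integral>x. f n x * (indicator A x * (\<phi>n n x - \<phi> x)) \<partial>M) + (\<integral>x. f n x * (indicator A x * \<phi> x) \<partial>M)" for n
    using int_f[of "\<phi>n n" n] int_f[of \<phi> n] \<phi>n_le \<phi>_le by (simp add: right_diff_distrib)
  then show ?thesis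
    using tendsto_add[OF dom l1] unfolding \<phi>_def \<phi>n_def by simp
qed

text \<open>For a set \<open>A\<close>, the truncated masses \<open>q j\<close> are squeezed between
  \<open>measure M (E j) - measure N (- D j)\<close> and \<open>measure M (E j)\<close>, both
  tending to \<open>measure M A\<close>; monotone convergence shows that they also tend to the mass
  of the limit density. The squeeze is the statement that no mass escapes.\<close>

lemma density_limit: "density M (\<lambda>x. ennreal (f' x) * (\<integral>\<^sup>+y. ennreal (p x y * g' y) \<partial>N)) = M"
proof (rule measure_eqI)
  fix A assume "A \<in> sets (density M (\<lambda>x. ennreal (f' x) * (\<integral>\<^sup>+y. ennreal (p x y * g' y) \<partial>N)))"
  then have A[measurable]: "A \<in> sets M" by simp
  define E where "E j = A \<inter> {x. F x \<le> real j}" for j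
  define D where "D j = {y. G y \<le> real j}" for j
  have E[measurable]: "E j \<in> sets M" for j
  proof -
    have "{x \<in> space M. F x \<le> real j} \<in> sets M" by measurable
    then show ?thesis unfolding E_def using A by (simp add: sp)
  qed
  have D[measurable]: "D j \<in> sets N" for j
  proof -
    have "{y \<in> space N. G y \<le> real j} \<in> sets N" by measurable
    then show ?thesis unfolding D_def by (simp add: sp)
  qed
  define q where "q j = (\<integral>x. f' x * (indicator (E j) x * (\<integral>y. g' y * (indicator (D j) y * p x y) \<partial>N)) \<partial>M)" for j
  have trunc: "(\<lambda>n. \<integral>x. f n x * (indicator (E j) x * (\<integral>y. g n y * (indicator (D j) y * (p x y + \<epsilon> n)) \<partial>N)) \<partial>M)
      \<longlonglongrightarrow> q j" for j
    unfolding q_def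
    by (rule truncated_coupling_limit[OF E D, where t="real j"]) (simp_all add: E_def D_def)
  \<comment> \<open>The level \<open>j\<close> is fixed while \<open>n\<close> tends to infinity;
    the bounds on rectangles are independent of \<open>n\<close> and survive.\<close>
  have q_bounds: "measure M (E j) - measure N (- D j) \<le> q j" "q j \<le> measure M (E j)" for j
    using LIMSEQ_le_const[OF trunc] LIMSEQ_le_const2[OF trunc] coupling[OF E D] by blast+
  have "(\<lambda>j. measure M (E j)) \<longlonglongrightarrow> measure M (\<Union>j. E j)"
  proof (rule M.finite_Lim_measure_incseq)
    show "incseq E" by (auto simp: E_def incseq_def)
  qed auto
  moreover have "(\<Union>j. E j) = A"
    unfolding E_def using real_arch_simple by auto
  ultimately have E_lim: "(\<lambda>j. measure M (E j)) \<longlonglongrightarrow> measure M A" by simp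
  have "(\<lambda>j. measure N (- D j)) \<longlonglongrightarrow> measure N (\<Inter>j. - D j)"
  proof (rule N.finite_Lim_measure_decseq)
    show "range (\<lambda>j. - D j) \<subseteq> sets N"
      using sets.compl_sets[OF D] by (auto simp: sp Compl_eq_Diff_UNIV)
    show "decseq (\<lambda>j. - D j)" by (auto simp: D_def decseq_def)
  qed
  moreover have "(\<Inter>j. - D j) = {}"
    unfolding D_def using real_arch_simple by auto
  ultimately have D_lim: "(\<lambda>j. measure N (- D j)) \<longlonglongrightarrow> 0" by simp
  have q_lim: "q \<longlonglongrightarrow> measure M A"
    by (rule tendsto_sandwich[OF _ _ tendsto_diff[OF E_lim D_lim, simplified] E_lim])
       (use q_bounds in auto)
  let ?\<phi> = "\<lambda>j x. \<integral>\<^sup>+y. ennreal (g' y * (indicator (D j) y * p x y)) \<partial>N"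
  \<comment> \<open>The truncated integrands are bounded, so real integrals and nonnegative
    integrals agree. The passage is needed because the untruncated inner integral is not known to be
    finite.\<close>
  have q_eq: "ennreal (q j) = (\<integral>\<^sup>+x. ennreal (f' x) * (indicator (E j) x * ?\<phi> j x) \<partial>M)" for j
  proof -
    have b: "0 \<le> g' y * (indicator (D j) y * p x y)" "g' y * (indicator (D j) y * p x y) \<le> real j * C" for x y
      using G(3,4)[of y] p_bounds[of x y] C_pos
      by (auto simp: indicator_def D_def intro!: mult_mono)
    have int: "integrable N (\<lambda>y. g' y * (indicator (D j) y * p x y))" for x
      using b by (intro N.integrable_const_bound[of _ "real j * C"]) auto
    define \<psi> where "\<psi> x = (\<integral>y. g' y * (indicator (D j) y * p x y) \<partial>N)" for x
    have \<psi>_meas[measurable]: "\<psi> \<in> borel_measurable M"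
      unfolding \<psi>_def[abs_def]
      by (rule N.borel_measurable_lebesgue_integral, use p in \<open>simp add: case_prod_beta'\<close>)
    have \<psi>: "?\<phi> j x = ennreal (\<psi> x)" for x
      unfolding \<psi>_def using int b by (intro nn_integral_eq_integral) auto
    have \<psi>b: "0 \<le> \<psi> x" "\<psi> x \<le> real j * C" for x
      unfolding \<psi>_def using int b by (auto intro!: integral_nonneg_AE N.integral_le_const)
    have eb: "0 \<le> f' x * (indicator (E j) x * \<psi> x)" "f' x * (indicator (E j) x * \<psi> x) \<le> real j * (real j * C)" for x
      using F(3,4)[of x] \<psi>b[of x] by (auto simp: indicator_def E_def C_pos less_imp_le intro!: mult_mono)
    have "(\<integral>\<^sup>+x. ennreal (f' x) * (indicator (E j) x * ?\<phi> j x) \<partial>M) = (\<integral>\<^sup>+x. ennreal (f' x * (indicator (E j) x * \<psi> x)) \<partial>M)"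
      unfolding \<psi> using F(3) \<psi>b by (intro nn_integral_cong) (auto simp: ennreal_mult indicator_def)
    also have "\<dots> = ennreal (\<integral>x. f' x * (indicator (E j) x * \<psi> x) \<partial>M)"
      using eb by (intro nn_integral_eq_integral M.integrable_const_bound[of _ "real j * (real j * C)"]) auto
    finally show ?thesis unfolding q_def \<psi>_def by simp
  qed
  have in_D: "\<forall>\<^sub>F j in sequentially. y \<in> D j" for y
    unfolding D_def using eventually_ge_at_top[of "nat \<lceil>G y\<rceil>"] by eventually_elim (simp add: nat_le_iff ceiling_le_iff)
  have in_E: "\<forall>\<^sub>F j in sequentially. x \<in> E j \<longleftrightarrow> x \<in> A" for x
    unfolding E_def using eventually_ge_at_top[of "nat \<lceil>F x\<rceil>"] by eventually_elim (simp add: nat_le_iff ceiling_le_iff)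
  have mono_D: "D i \<subseteq> D j" and mono_E: "E i \<subseteq> E j" if "i \<le> j" for i j
    using that unfolding D_def E_def by auto
  have \<phi>_mono: "?\<phi> i x \<le> ?\<phi> j x" if "i \<le> j" for i j x
    using mono_D[OF that] G(3) p_bounds(1)
    by (intro nn_integral_mono) (auto simp: indicator_def less_imp_le)
  have \<phi>_lim: "(\<lambda>j. ?\<phi> j x) \<longlonglongrightarrow> (\<integral>\<^sup>+y. ennreal (p x y * g' y) \<partial>N)" for x
  proof (rule nn_integral_LIMSEQ)
    show "incseq (\<lambda>j y. ennreal (g' y * (indicator (D j) y * p x y)))"
    proof (intro incseq_SucI le_funI)
      show "ennreal (g' y * (indicator (D j) y * p x y)) \<le> ennreal (g' y * (indicator (D (Suc j)) y * p x y))" for j y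
        using mono_D[of j "Suc j"] G(3)[of y] p_bounds(1)[of x y] by (auto simp: indicator_def)
    qed
    fix y
    have "\<forall>\<^sub>F j in sequentially. ennreal (g' y * (indicator (D j) y * p x y)) = ennreal (p x y * g' y)"
      using in_D[of y] by eventually_elim (simp add: mult.commute)
    then show "(\<lambda>j. ennreal (g' y * (indicator (D j) y * p x y))) \<longlonglongrightarrow> ennreal (p x y * g' y)"
      by (rule tendsto_eventually)
  qed measurable
  have \<phi>_meas[measurable]: "?\<phi> j \<in> borel_measurable M" for j
    by (rule N.borel_measurable_nn_integral) (use p in \<open>simp add: case_prod_beta'\<close>)
  have lim_meas[measurable]: "(\<lambda>x. \<integral>\<^sup>+y. ennreal (p x y * g' y) \<partial>N) \<in> borel_measurable M"
    by (rule N.borel_measurable_nn_integral) (use p in \<open>simp add: case_prod_beta'\<close>)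
  have "(\<lambda>j. \<integral>\<^sup>+x. ennreal (f' x) * (indicator (E j) x * ?\<phi> j x) \<partial>M)
      \<longlonglongrightarrow> (\<integral>\<^sup>+x. ennreal (f' x) * (\<integral>\<^sup>+y. ennreal (p x y * g' y) \<partial>N) * indicator A x \<partial>M)"
  proof (rule nn_integral_LIMSEQ)
    show "incseq (\<lambda>j x. ennreal (f' x) * (indicator (E j) x * ?\<phi> j x))"
    proof (intro incseq_SucI le_funI mult_left_mono mult_mono)
      show "indicator (E j) x \<le> (indicator (E (Suc j)) x :: ennreal)" for j x
        using mono_E[of j "Suc j"] by (auto simp: indicator_def)
    qed (use \<phi>_mono in auto)
    fix x
    \<comment> \<open>The factor in front must be finite and independent of \<open>j\<close>, hence
      \<open>A\<close> in place of \<open>E j\<close>; at a given point the two indicators agree for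
      large \<open>j\<close>.\<close>
    have "(\<lambda>j. ennreal (f' x) * indicator A x * ?\<phi> j x)
        \<longlonglongrightarrow> ennreal (f' x) * indicator A x * (\<integral>\<^sup>+y. ennreal (p x y * g' y) \<partial>N)"
      by (intro ennreal_tendsto_cmult \<phi>_lim) (auto simp: indicator_def)
    moreover have "\<forall>\<^sub>F j in sequentially. ennreal (f' x) * indicator A x * ?\<phi> j x
        = ennreal (f' x) * (indicator (E j) x * ?\<phi> j x)"
      using in_E[of x] by eventually_elim (simp add: indicator_def)
    ultimately show "(\<lambda>j. ennreal (f' x) * (indicator (E j) x * ?\<phi> j x))
        \<longlonglongrightarrow> ennreal (f' x) * (\<integral>\<^sup>+y. ennreal (p x y * g' y) \<partial>N) * indicator A x"
      by (rule Lim_transform_eventually[THEN tendsto_eq_rhs]) (simp add: mult_ac)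
  qed measurable
  moreover have "(\<lambda>j. ennreal (q j)) \<longlonglongrightarrow> emeasure M A"
    using tendsto_ennrealI[OF q_lim] by (simp add: M.emeasure_eq_measure)
  ultimately have "(\<integral>\<^sup>+x. ennreal (f' x) * (\<integral>\<^sup>+y. ennreal (p x y * g' y) \<partial>N) * indicator A x \<partial>M) = emeasure M A"
    unfolding q_eq by (rule LIMSEQ_unique)
  then show "emeasure (density M (\<lambda>x. ennreal (f' x) * (\<integral>\<^sup>+y. ennreal (p x y * g' y) \<partial>N))) A = emeasure M A"
    by (simp add: emeasure_density)
qed simp

end

section \<open>Existence\<close>

text \<open>The bounds on \<open>f\<close> and \<open>g\<close> are free of \<open>e\<close>. Once
  \<open>g\<close> has mass one on \<open>B\<close>, the first equation gives 1 / f(x) \<ge>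
  \<alpha>(x). The coupling mass of A x B is at least \<open>measure M A + measure N B - 1\<close>
  and at most \<open>C + 1\<close> times the mass of \<open>f\<close> on \<open>A\<close>; with this
  lower bound for the mass, the second equation bounds \<open>g\<close>.\<close>

lemma perturbed_factors_exist:
  fixes M :: "'a measure" and N :: "'b measure"
  assumes "prob_space M" "prob_space N" and sp: "space M = UNIV" "space N = UNIV"
    and p[measurable]: "case_prod p \<in> borel_measurable (M \<Otimes>\<^sub>M N)"
    and p_bounds: "\<And>x y. 0 < p x y" "\<And>x y. p x y \<le> C"
    and e: "0 < e" "e \<le> (1::real)"
    and AB[measurable]: "A \<in> sets M" "B \<in> sets N" and large: "1 < measure M A + measure N B"
    and \<alpha>: "\<And>x. 0 < \<alpha> x" "\<And>x y. y \<in> B \<Longrightarrow> \<alpha> x \<le> p x y"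
    and \<beta>: "\<And>y. 0 < \<beta> y" "\<And>x y. x \<in> A \<Longrightarrow> \<beta> y \<le> p x y"
  obtains f g where "bounded_kernel M N (\<lambda>x y. p x y + e) e (C + 1)"
    "bounded_away M f" "bounded_away N g"
    "\<And>x. f x * (\<integral>y. (p x y + e) * g y \<partial>N) = 1" "\<And>y. g y * (\<integral>x. (p x y + e) * f x \<partial>M) = 1"
    "\<And>x. f x \<le> 1 / \<alpha> x" "\<And>y. g y \<le> (C + 1) / ((measure M A + measure N B - 1) * \<beta> y)"
proof -
  interpret bounded_kernel M N "\<lambda>x y. p x y + e" e "C + 1"
  proof -
    interpret M: prob_space M by fact
    interpret N: prob_space N by fact
    show "bounded_kernel M N (\<lambda>x y. p x y + e) e (C + 1)"
    proof
      show "(\<lambda>(x, y). p x y + e) \<in> borel_measurable (M \<Otimes>\<^sub>M N)"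
        using p by (simp add: case_prod_beta')
      show "e \<le> p x y + e" "p x y + e \<le> C + 1" for x y
        using p_bounds[of x y] e by simp_all
    qed (use sp e in auto)
  qed
  obtain f0 g0 where 0: "bounded_away M f0" "bounded_away N g0"
    "\<And>x. f0 x * (\<integral>y. (p x y + e) * g0 y \<partial>N) = 1" "\<And>y. g0 y * (\<integral>x. (p x y + e) * f0 x \<partial>M) = 1"
    using schroedinger_factors_exist by blast
  \<comment> \<open>Dividing \<open>g0\<close> and multiplying \<open>f0\<close> by this mass leaves
    the equations intact and normalises \<open>g\<close> on \<open>B\<close>. It is positive because
    \<open>measure M A \<le> 1\<close> forces \<open>measure N B > 0\<close>.\<close>
  define s where "s = (\<integral>y. g0 y * indicator B y \<partial>N)"
  have int_B: "integrable N (\<lambda>y. g y * indicator B y)" if "integrable N g" for g :: "'b \<Rightarrow> real"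
    using that by (intro integrable_real_mult_indicator) auto
  have s: "0 < s"
  proof -
    obtain a where a: "0 < a" "\<And>y. a \<le> g0 y" using 0(2) unfolding bounded_away_def by blast
    have "0 < measure N B" using large M.prob_le_1[of A] by linarith
    then have "0 < a * measure N B" using a(1) by simp
    also have "\<dots> = (\<integral>y. a * indicator B y \<partial>N)" by simp
    also have "\<dots> \<le> s"
      unfolding s_def using a(2) N.bounded_away_integrable[OF 0(2)]
      by (intro integral_mono int_B) (auto simp: indicator_def)
    finally show ?thesis .
  qed
  define f where "f x = s * f0 x" for x
  define g where "g y = g0 y / s" for y
  have f: "bounded_away M f"
  proof -
    obtain a b where "f0 \<in> borel_measurable M" "0 < a" "\<And>x. a \<le> f0 x" "\<And>x. f0 x \<le> b"
      using 0(1) unfolding bounded_away_def by blast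
    then show ?thesis
      unfolding bounded_away_def f_def using s
      by (intro conjI exI[of _ "s * a"] exI[of _ "s * b"]) simp_all
  qed
  have g: "bounded_away N g"
  proof -
    obtain a b where "g0 \<in> borel_measurable N" "0 < a" "\<And>y. a \<le> g0 y" "\<And>y. g0 y \<le> b"
      using 0(2) unfolding bounded_away_def by blast
    then show ?thesis
      unfolding bounded_away_def g_def using s
      by (intro conjI exI[of _ "a / s"] exI[of _ "b / s"]) (simp_all add: divide_right_mono)
  qed
  have fM: "f x * (\<integral>y. (p x y + e) * g y \<partial>N) = 1" for x
    using 0(3)[of x] s unfolding f_def g_def by simp
  have gN: "g y * (\<integral>x. (p x y + e) * f x \<partial>M) = 1" for y
  proof -
    have "(\<integral>x. (p x y + e) * f x \<partial>M) = (\<integral>x. s * ((p x y + e) * f0 x) \<partial>M)"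
      unfolding f_def by (intro Bochner_Integration.integral_cong) simp_all
    then show ?thesis using 0(4)[of y] s unfolding g_def by simp
  qed
  note f_pos = bounded_away_pos[OF f] and g_pos = bounded_away_pos[OF g]
  have int_f: "integrable M f" and int_g: "integrable N g"
    using M.bounded_away_integrable[OF f] N.bounded_away_integrable[OF g] .
  interpret swapped: bounded_kernel N M "\<lambda>y x. p x y + e" e "C + 1" by (rule swap)
  have gB: "(\<integral>y. g y * indicator B y \<partial>N) = 1"
    using s unfolding g_def by (simp add: s_def)
  have f_le: "f x \<le> 1 / \<alpha> x" for x
  proof -
    have "\<alpha> x = (\<integral>y. \<alpha> x * (g y * indicator B y) \<partial>N)" using gB by simp
    also have "\<dots> \<le> (\<integral>y. (p x y + e) * g y \<partial>N)"
    proof (rule integral_mono)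
      show "\<alpha> x * (g y * indicator B y) \<le> (p x y + e) * g y" for y
        using \<alpha>(2)[of y x] p_bounds(1)[of x y] e g_pos[of y]
        by (auto simp: indicator_def intro!: mult_right_mono)
    qed (use int_B int_g integrable_p in auto)
    finally have "f x * \<alpha> x \<le> 1"
      using mult_left_mono[OF _ less_imp_le[OF f_pos[of x]]] fM[of x] by fastforce
    then show ?thesis using \<alpha>(1)[of x] by (simp add: field_simps)
  qed
  define k where "k = measure M A + measure N B - 1"
  have k: "0 < k" unfolding k_def using large by simp
  define \<eta> where "\<eta> = (\<integral>x. f x * indicator A x \<partial>M)"
  have int_A: "integrable M (\<lambda>x. f x * indicator A x)"
    using int_f by (intro integrable_real_mult_indicator) auto
  \<comment> \<open>Compares the two estimates of the mass of A x B: from below by the marginals,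
    from above by \<open>p x y + e \<le> C + 1\<close> and the normalisation on
    \<open>B\<close>.\<close>
  have \<eta>: "k \<le> (C + 1) * \<eta>"
  proof -
    have cB: "measure N (- B) = 1 - measure N B"
      using N.prob_compl[of B] by (simp add: sp Compl_eq_Diff_UNIV)
    have inner: "(\<integral>y. g y * (indicator B y * (p x y + e)) \<partial>N) \<le> C + 1"
        "0 \<le> (\<integral>y. g y * (indicator B y * (p x y + e)) \<partial>N)" for x
    proof -
      have "(\<integral>y. g y * (indicator B y * (p x y + e)) \<partial>N) \<le> (\<integral>y. (C + 1) * (g y * indicator B y) \<partial>N)"
      proof (rule integral_mono)
        show "integrable N (\<lambda>y. g y * (indicator B y * (p x y + e)))"
          using integrable_p[OF int_B[OF int_g], of x] by (simp add: mult_ac)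
        show "g y * (indicator B y * (p x y + e)) \<le> (C + 1) * (g y * indicator B y)" for y
          using p_bounds(2)[of x y] e g_pos[of y] by (auto simp: indicator_def mult.commute)
      qed (use int_B int_g in auto)
      then show "(\<integral>y. g y * (indicator B y * (p x y + e)) \<partial>N) \<le> C + 1" using gB by simp
      show "0 \<le> (\<integral>y. g y * (indicator B y * (p x y + e)) \<partial>N)"
        using g_pos p_pos by (intro integral_nonneg_AE) (auto simp: less_imp_le)
    qed
    have "k \<le> (\<integral>x. f x * (indicator A x * (\<integral>y. g y * (indicator B y * (p x y + e)) \<partial>N)) \<partial>M)"
      using coupling_bounds(1)[OF f g fM gN AB] unfolding cB k_def by simp
    also have "\<dots> \<le> (\<integral>x. (C + 1) * (f x * indicator A x) \<partial>M)"
    proof (rule integral_mono')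
      show "f x * (indicator A x * (\<integral>y. g y * (indicator B y * (p x y + e)) \<partial>N)) \<le> (C + 1) * (f x * indicator A x)" for x
        using inner[of x] f_pos[of x] by (auto simp: indicator_def mult.commute)
    qed (use int_A f_pos C_pos in \<open>auto simp: less_imp_le\<close>)
    finally show ?thesis unfolding \<eta>_def by simp
  qed
  have g_le: "g y \<le> (C + 1) / (k * \<beta> y)" for y
  proof -
    have "\<beta> y * \<eta> = (\<integral>x. \<beta> y * (f x * indicator A x) \<partial>M)" unfolding \<eta>_def by simp
    also have "\<dots> \<le> (\<integral>x. (p x y + e) * f x \<partial>M)"
    proof (rule integral_mono)
      show "\<beta> y * (f x * indicator A x) \<le> (p x y + e) * f x" for x
        using \<beta>(2)[of x y] p_bounds(1)[of x y] e f_pos[of x]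
        by (auto simp: indicator_def intro!: mult_right_mono)
    qed (use int_A int_f swapped.integrable_p in auto)
    finally have 1: "g y * (\<beta> y * \<eta>) \<le> 1"
      using mult_left_mono[OF _ less_imp_le[OF g_pos[of y]]] gN[of y] by fastforce
    have "g y * (k * \<beta> y) \<le> g y * (((C + 1) * \<eta>) * \<beta> y)"
      using \<eta> \<beta>(1)[of y] g_pos[of y] by (intro mult_left_mono mult_right_mono) (auto simp: less_imp_le)
    also have "\<dots> = (C + 1) * (g y * (\<beta> y * \<eta>))" by (simp add: mult_ac)
    also have "\<dots> \<le> C + 1" using mult_left_mono[OF 1, of "C + 1"] C_pos by simp
    finally show ?thesis using k \<beta>(1)[of y] by (simp add: pos_le_divide_eq)
  qed
  show thesis
    by (rule that[OF bounded_kernel_axioms f g fM gN f_le g_le[unfolded k_def]])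
qed

lemma schroedinger_solution_exists:
  fixes M :: "'a::second_countable_topology measure" and N :: "'b::second_countable_topology measure"
  assumes "prob_space M" "prob_space N" and sets: "sets M = sets borel" "sets N = sets borel"
    and p[measurable]: "case_prod p \<in> borel_measurable (M \<Otimes>\<^sub>M N)"
    and p_bounds: "\<And>x y. 0 < p x y" "\<And>x y. p x y \<le> C"
    and AB: "A \<in> sets M" "B \<in> sets N" and large: "1 < measure M A + measure N B"
    and [measurable]: "\<alpha> \<in> borel_measurable M" "\<beta> \<in> borel_measurable N"
    and \<alpha>: "\<And>x. 0 < \<alpha> x" "\<And>x y. y \<in> B \<Longrightarrow> \<alpha> x \<le> p x y"
    and \<beta>: "\<And>y. 0 < \<beta> y" "\<And>x y. x \<in> A \<Longrightarrow> \<beta> y \<le> p x y"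
  shows "\<exists>a b. schroedinger_solution p M N a b"
proof -
  interpret M: prob_space M by fact
  interpret N: prob_space N by fact
  have sp: "space M = UNIV" "space N = UNIV"
    using sets_eq_imp_space_eq[OF sets(1)] sets_eq_imp_space_eq[OF sets(2)] by simp_all
  define e where "e n = inverse (real (Suc n))" for n
  have e: "0 < e n" "e n \<le> 1" "e \<longlonglongrightarrow> 0" for n
    unfolding e_def using LIMSEQ_inverse_real_of_nat by (auto simp: field_simps)
  define k where "k = measure M A + measure N B - 1"
  have k: "0 < k" unfolding k_def using large by simp
  define F where "F x = 1 / \<alpha> x" for x
  define G where "G y = (C + 1) / (k * \<beta> y)" for y
  have C: "0 < C" using p_bounds[of undefined undefined] by simp
  have FG_pos: "0 < F x" "0 < G y" for x y
    unfolding F_def G_def using \<alpha>(1) \<beta>(1) k C by simp_all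
  have FG_meas[measurable]: "F \<in> borel_measurable M" "G \<in> borel_measurable N"
    unfolding F_def G_def by measurable
  \<comment> \<open>All properties go into one predicate so that a single choice for each
    \<open>n\<close> yields matching pairs of factors.\<close>
  define Q where "Q n f g \<longleftrightarrow> bounded_kernel M N (\<lambda>x y. p x y + e n) (e n) (C + 1) \<and>
      bounded_away M f \<and> bounded_away N g \<and>
      (\<forall>x. f x * (\<integral>y. (p x y + e n) * g y \<partial>N) = 1) \<and> (\<forall>y. g y * (\<integral>x. (p x y + e n) * f x \<partial>M) = 1) \<and>
      (\<forall>x. f x \<le> F x) \<and> (\<forall>y. g y \<le> G y)" for n f g
  have "\<exists>f g. Q n f g" for n
  proof (rule perturbed_factors_exist[OF assms(1,2) sp p p_bounds e(1,2)[of n] AB large \<alpha> \<beta>])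
    fix f g assume "bounded_kernel M N (\<lambda>x y. p x y + e n) (e n) (C + 1)" "bounded_away M f" "bounded_away N g"
      "\<And>x. f x * (\<integral>y. (p x y + e n) * g y \<partial>N) = 1" "\<And>y. g y * (\<integral>x. (p x y + e n) * f x \<partial>M) = 1"
      "\<And>x. f x \<le> 1 / \<alpha> x" "\<And>y. g y \<le> (C + 1) / ((measure M A + measure N B - 1) * \<beta> y)"
    then show ?thesis unfolding Q_def F_def G_def k_def
      by (intro exI[of _ f] exI[of _ g] conjI allI)
  qed
  then obtain f g where Q: "\<And>n. Q n (f n) (g n)" by metis
  have K: "bounded_kernel M N (\<lambda>x y. p x y + e n) (e n) (C + 1)"
    and f: "bounded_away M (f n)" and g: "bounded_away N (g n)"
    and fM: "f n x * (\<integral>y. (p x y + e n) * g n y \<partial>N) = 1"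
    and gN: "g n y * (\<integral>x. (p x y + e n) * f n x \<partial>M) = 1"
    and f_le: "f n x \<le> F x" and g_le: "g n y \<le> G y" for n x y
    using Q[of n] unfolding Q_def by blast+
  have fg_meas[measurable]: "f n \<in> borel_measurable M" "g n \<in> borel_measurable N" for n
    using f[of n] g[of n] unfolding bounded_away_def by simp_all
  have fg_nonneg: "0 \<le> f n x" "0 \<le> g n y" for n x y
    using bounded_away_pos[OF f, of n x] bounded_away_pos[OF g, of n y] by simp_all
  obtain r f' where r: "strict_mono (r :: nat \<Rightarrow> nat)" and f'[measurable]: "f' \<in> borel_measurable M"
    and f'_b: "\<And>x. 0 \<le> f' x" "\<And>x. f' x \<le> F x"
    and f_lim: "\<And>\<psi> b. \<psi> \<in> borel_measurable M \<Longrightarrow> (\<And>x. \<bar>F x * \<psi> x\<bar> \<le> b) \<Longrightarrow>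
      (\<lambda>n. \<integral>x. f (r n) x * \<psi> x \<partial>M) \<longlonglongrightarrow> (\<integral>x. f' x * (\<psi> x :: real) \<partial>M)"
    by (rule dominated_functions_weak_compact[where f=f, OF M.finite_measure_axioms sets(1) fg_meas(1) FG_meas(1)
          FG_pos(1) fg_nonneg(1) f_le]) blast
  \<comment> \<open>The second extraction runs along the first subsequence, so that both weak limits
    hold along the composition.\<close>
  obtain r' g' where r': "strict_mono (r' :: nat \<Rightarrow> nat)" and g'[measurable]: "g' \<in> borel_measurable N"
    and g'_b: "\<And>y. 0 \<le> g' y" "\<And>y. g' y \<le> G y"
    and g_lim: "\<And>\<psi> b. \<psi> \<in> borel_measurable N \<Longrightarrow> (\<And>y. \<bar>G y * \<psi> y\<bar> \<le> b) \<Longrightarrow>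
      (\<lambda>n. \<integral>y. g (r (r' n)) y * \<psi> y \<partial>N) \<longlonglongrightarrow> (\<integral>y. g' y * (\<psi> y :: real) \<partial>N)"
    by (rule dominated_functions_weak_compact[where f="\<lambda>n. g (r n)", OF N.finite_measure_axioms sets(2) fg_meas(2) FG_meas(2)
          FG_pos(2) fg_nonneg(2) g_le]) blast
  define t where "t = r \<circ> r'"
  have t: "strict_mono t" unfolding t_def using r r' by (rule strict_mono_o)
  have e_lim: "(\<lambda>n. e (t n)) \<longlonglongrightarrow> 0"
    using LIMSEQ_subseq_LIMSEQ[OF e(3) t] by (simp add: o_def)
  have f_lim': "(\<lambda>n. \<integral>x. f (t n) x * \<psi> x \<partial>M) \<longlonglongrightarrow> (\<integral>x. f' x * \<psi> x \<partial>M)"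
    if "\<psi> \<in> borel_measurable M" "\<And>x. \<bar>F x * \<psi> x\<bar> \<le> b" for \<psi> b
    using LIMSEQ_subseq_LIMSEQ[OF f_lim[OF that] r'] by (simp add: o_def t_def)
  have g_lim': "(\<lambda>n. \<integral>y. g (t n) y * \<psi> y \<partial>N) \<longlonglongrightarrow> (\<integral>y. g' y * \<psi> y \<partial>N)"
    if "\<psi> \<in> borel_measurable N" "\<And>y. \<bar>G y * \<psi> y\<bar> \<le> b" for \<psi> b
    using g_lim[OF that] by (simp add: t_def)
  interpret lim: coupling_limit M N p C "\<lambda>n. e (t n)" "\<lambda>n. f (t n)" f' F "\<lambda>n. g (t n)" g' G
    by unfold_locales
      ((rule p sp p_bounds e_lim less_imp_le[OF e(1)] e(2) fg_meas f' g' FG_meas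
        fg_nonneg f_le g_le f'_b g'_b)
        | (rule bounded_kernel.coupling_bounds[OF K f g fM gN]; assumption)
        | (rule f_lim' g_lim'; blast))+
  have p_swap: "(\<lambda>(y, x). p x y) \<in> borel_measurable (N \<Otimes>\<^sub>M M)"
    using measurable_pair_swap[OF p] by simp
  interpret lim': coupling_limit N M "\<lambda>y x. p x y" C "\<lambda>n. e (t n)" "\<lambda>n. g (t n)" g' G "\<lambda>n. f (t n)" f' F
    by unfold_locales
      ((rule p_swap sp p_bounds e_lim less_imp_le[OF e(1)] e(2) fg_meas f' g' FG_meas
        fg_nonneg f_le g_le f'_b g'_b)
        | (rule bounded_kernel.coupling_bounds[OF bounded_kernel.swap[OF K] g f gN fM]; assumption)
        | (rule f_lim' g_lim'; blast))+
  have p_sec: "(\<lambda>y. p x y) \<in> borel_measurable N" "(\<lambda>x. p x y) \<in> borel_measurable M" for x y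
    by (rule lim.p_sec lim'.p_sec)+
  let ?a = "density M (\<lambda>x. ennreal (f' x))" and ?b = "density N (\<lambda>y. ennreal (g' y))"
  have "schroedinger_solution p M N ?a ?b"
    unfolding schroedinger_solution_def
  proof (intro conjI)
    show "sigma_finite_measure ?a" "sigma_finite_measure ?b"
      \<comment> \<open>The limit densities are real-valued, hence finite everywhere, even where
        their total mass is infinite.\<close>
      by (simp_all add: M.sigma_finite_iff_density_finite N.sigma_finite_iff_density_finite)
    show "sets ?a = sets borel" "sets ?b = sets borel" using sets by simp_all
    have 1: "(\<integral>\<^sup>+y. ennreal (p x y) \<partial>?b) = (\<integral>\<^sup>+y. ennreal (p x y * g' y) \<partial>N)" for x
      using p_sec g'_b(1) p_bounds(1)
      by (subst nn_integral_density) (auto simp: ennreal_mult' less_imp_le mult.commute)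
    have 2: "(\<integral>\<^sup>+x. ennreal (p x y) \<partial>?a) = (\<integral>\<^sup>+x. ennreal (p x y * f' x) \<partial>M)" for y
      using p_sec f'_b(1) p_bounds(1)
      by (subst nn_integral_density) (auto simp: ennreal_mult' less_imp_le mult.commute)
    have [measurable]: "(\<lambda>x. \<integral>\<^sup>+y. ennreal (p x y * g' y) \<partial>N) \<in> borel_measurable M"
      by (rule N.borel_measurable_nn_integral) (use p in \<open>simp add: case_prod_beta'\<close>)
    have [measurable]: "(\<lambda>y. \<integral>\<^sup>+x. ennreal (p x y * f' x) \<partial>M) \<in> borel_measurable N"
      by (rule M.borel_measurable_nn_integral) (use p_swap in \<open>simp add: case_prod_beta'\<close>)
    show "density ?a (\<lambda>x. \<integral>\<^sup>+y. ennreal (p x y) \<partial>?b) = M"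
      unfolding 1 by (subst density_density_eq) (simp_all add: lim.density_limit)
    show "density ?b (\<lambda>y. \<integral>\<^sup>+x. ennreal (p x y) \<partial>?a) = N"
      unfolding 2 by (subst density_density_eq) (simp_all add: lim'.density_limit)
  qed
  then show ?thesis by blast
qed

section \<open>Solutions and their densities\<close>

text \<open>Since \<open>\<phi>\<close> has integral one against \<open>a\<close>, it is finite
  \<open>a\<close>-almost everywhere and may be inverted: \<open>a\<close> has density
  \<open>1 / \<phi>\<close> with respect to \<open>M\<close>.\<close>

lemma density_reciprocal:
  assumes "prob_space M" and eq: "density a \<phi> = M"
    and [measurable]: "\<phi> \<in> borel_measurable a" and pos: "\<And>x. 0 < \<phi> x"
  obtains f :: "'a \<Rightarrow> real" where "f \<in> borel_measurable M" "\<And>x. 0 < f x"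
    "a = density M (\<lambda>x. ennreal (f x))" "AE x in M. ennreal (f x) * \<phi> x = 1"
proof -
  interpret M: prob_space M by fact
  have sets: "sets M = sets a" unfolding eq[symmetric] by simp
  have "(\<integral>\<^sup>+x. \<phi> x \<partial>a) = emeasure (density a \<phi>) (space a)"
    by (simp add: emeasure_density cong: nn_integral_cong)
  also have "\<dots> = 1"
    unfolding eq using M.emeasure_space_1 sets_eq_imp_space_eq[OF sets] by simp
  finally have fin: "AE x in a. \<phi> x \<noteq> \<infinity>"
    by (intro nn_integral_noteq_infinite) auto
  \<comment> \<open>The value 1 where \<open>\<phi>\<close> is infinite keeps \<open>f\<close>
    positive everywhere; that set is null for \<open>a\<close>, hence for \<open>M\<close>.\<close>
  define f where "f x = (if \<phi> x = \<infinity> then 1 else inverse (enn2real (\<phi> x)))" for x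
  have f_meas: "f \<in> borel_measurable a" unfolding f_def by measurable
  have f_pos: "0 < f x" for x
    unfolding f_def using pos[of x] by (simp add: enn2real_positive_iff less_top)
  have one: "ennreal (f x) * \<phi> x = 1" if fx: "\<phi> x \<noteq> \<infinity>" for x
  proof -
    have r: "0 < enn2real (\<phi> x)" "\<phi> x = ennreal (enn2real (\<phi> x))"
      using pos[of x] fx by (simp_all add: enn2real_positive_iff less_top)
    have "ennreal (f x) * \<phi> x = ennreal (inverse (enn2real (\<phi> x))) * ennreal (enn2real (\<phi> x))"
      using fx r(2) by (simp add: f_def)
    also have "\<dots> = 1"
      using r(1) by (simp flip: ennreal_mult)
    finally show ?thesis .
  qed
  have "density M (\<lambda>x. ennreal (f x)) = density a (\<lambda>x. \<phi> x * ennreal (f x))"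
    unfolding eq[symmetric] using f_meas by (subst density_density_eq) auto
  also have "\<dots> = density a (\<lambda>_. 1)"
  proof (rule density_cong)
    show "AE x in a. \<phi> x * ennreal (f x) = 1"
      using fin by eventually_elim (subst mult.commute, rule one)
  qed (use f_meas in auto)
  also have "\<dots> = a" by (rule density_1)
  finally have "a = density M (\<lambda>x. ennreal (f x))" by simp
  moreover have "AE x in M. ennreal (f x) * \<phi> x = 1"
    unfolding eq[symmetric] using fin by (subst AE_density) (auto intro: one elim!: eventually_mono)
  moreover have "f \<in> borel_measurable M"
    using f_meas unfolding measurable_cong_sets[OF sets refl] .
  ultimately show thesis using f_pos by (intro that)
qed

text \<open>A measure with a probability measure among its densities is not the zero measure, so a
  strictly positive function has a positive integral. This supplies the positivity required by
  \<open>density_reciprocal\<close>.\<close>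

lemma nn_integral_pos_of_density:
  assumes "prob_space N" and eq: "density b \<psi> = N" and [measurable]: "\<psi> \<in> borel_measurable b"
    and [measurable]: "k \<in> borel_measurable b" and pos: "\<And>y. 0 < k y"
  shows "0 < (\<integral>\<^sup>+y. k y \<partial>b)"
proof (rule ccontr)
  assume "\<not> 0 < (\<integral>\<^sup>+y. k y \<partial>b)"
  then have "AE y in b. k y = 0"
    by (simp add: nn_integral_0_iff_AE)
  then have "AE y in b. \<psi> y = 0"
    by eventually_elim (use pos in \<open>simp add: less_le\<close>)
  then have "AE y in N. False"
    unfolding eq[symmetric] by (subst AE_density) (auto elim!: eventually_mono)
  then show False
    using prob_space.AE_False[OF \<open>prob_space N\<close>] by simp
qed

text \<open>The first equation says that \<open>M\<close> has a density with respect to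
  \<open>a\<close>, the second that \<open>N\<close> has one with respect to \<open>b\<close>.
  Inverting both expresses the unknown measures by positive functions, the form in which the
  variables can be separated.\<close>

lemma schroedinger_solution_factors:
  fixes M :: "'a::topological_space measure" and N :: "'b::topological_space measure"
  assumes "prob_space M" "prob_space N" and sets: "sets M = sets borel" "sets N = sets borel"
    and p: "case_prod p \<in> borel_measurable (M \<Otimes>\<^sub>M N)" and p_pos: "\<And>x y. 0 < p x y"
    and sol: "schroedinger_solution p M N a b"
  obtains f g where "f \<in> borel_measurable M" "g \<in> borel_measurable N" "\<And>x. 0 < f x" "\<And>y. 0 < g y"
    "a = density M (\<lambda>x. ennreal (f x))" "b = density N (\<lambda>y. ennreal (g y))"
    "AE x in M. (\<integral>\<^sup>+y. ennreal (f x * p x y * g y) \<partial>N) = 1"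
    "AE y in N. (\<integral>\<^sup>+x. ennreal (f x * p x y * g y) \<partial>M) = 1"
proof -
  interpret M: prob_space M by fact
  interpret N: prob_space N by fact
  interpret a: sigma_finite_measure a using sol unfolding schroedinger_solution_def by blast
  interpret b: sigma_finite_measure b using sol unfolding schroedinger_solution_def by blast
  have ab: "sets a = sets M" "sets b = sets N"
    and aM: "density a (\<lambda>x. \<integral>\<^sup>+y. ennreal (p x y) \<partial>b) = M"
    and bN: "density b (\<lambda>y. \<integral>\<^sup>+x. ennreal (p x y) \<partial>a) = N"
    using sol sets unfolding schroedinger_solution_def by auto
  have sp: "space M = UNIV" "space N = UNIV" "space a = UNIV" "space b = UNIV"
    using sets_eq_imp_space_eq[OF sets(1)] sets_eq_imp_space_eq[OF sets(2)]
      sets_eq_imp_space_eq[OF ab(1)] sets_eq_imp_space_eq[OF ab(2)] by simp_all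
  have p_ab: "case_prod p \<in> borel_measurable (a \<Otimes>\<^sub>M b)"
    using p unfolding measurable_cong_sets[OF sets_pair_measure_cong[OF ab] refl] .
  have p_ba: "(\<lambda>(y, x). p x y) \<in> borel_measurable (b \<Otimes>\<^sub>M a)"
    using measurable_pair_swap[OF p_ab] by simp
  have sec: "(\<lambda>y. p x y) \<in> borel_measurable N" "(\<lambda>x. p x y) \<in> borel_measurable M" for x y
  proof -
    show "(\<lambda>y. p x y) \<in> borel_measurable N"
      using measurable_compose[OF measurable_Pair1' p, of x] by (simp add: sp)
    show "(\<lambda>x. p x y) \<in> borel_measurable M"
      using measurable_compose[OF measurable_Pair2' p, of y] by (simp add: sp)
  qed
  have sec': "(\<lambda>y. p x y) \<in> borel_measurable b" "(\<lambda>x. p x y) \<in> borel_measurable a" for x y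
    using sec measurable_cong_sets[OF ab(1) refl] measurable_cong_sets[OF ab(2) refl] by blast+
  have \<phi>[measurable]: "(\<lambda>x. \<integral>\<^sup>+y. ennreal (p x y) \<partial>b) \<in> borel_measurable a"
    by (rule b.borel_measurable_nn_integral) (use p_ab in \<open>simp add: case_prod_beta'\<close>)
  have \<psi>[measurable]: "(\<lambda>y. \<integral>\<^sup>+x. ennreal (p x y) \<partial>a) \<in> borel_measurable b"
    by (rule a.borel_measurable_nn_integral) (use p_ba in \<open>simp add: case_prod_beta'\<close>)
  have \<phi>_pos: "0 < (\<integral>\<^sup>+y. ennreal (p x y) \<partial>b)" for x
    by (rule nn_integral_pos_of_density[OF \<open>prob_space N\<close> bN \<psi>])
      (use sec' p_pos in auto)
  have \<psi>_pos: "0 < (\<integral>\<^sup>+x. ennreal (p x y) \<partial>a)" for y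
    by (rule nn_integral_pos_of_density[OF \<open>prob_space M\<close> aM \<phi>])
      (use sec' p_pos in auto)
  obtain f where f[measurable]: "f \<in> borel_measurable M" and f_pos: "\<And>x. 0 < f x"
    and af: "a = density M (\<lambda>x. ennreal (f x))"
    and f1: "AE x in M. ennreal (f x) * (\<integral>\<^sup>+y. ennreal (p x y) \<partial>b) = 1"
    using density_reciprocal[OF \<open>prob_space M\<close> aM \<phi> \<phi>_pos] by blast
  obtain g where g[measurable]: "g \<in> borel_measurable N" and g_pos: "\<And>y. 0 < g y"
    and bg: "b = density N (\<lambda>y. ennreal (g y))"
    and g1: "AE y in N. ennreal (g y) * (\<integral>\<^sup>+x. ennreal (p x y) \<partial>a) = 1"
    using density_reciprocal[OF \<open>prob_space N\<close> bN \<psi> \<psi>_pos] by blast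
  \<comment> \<open>Inserting the density of \<open>b\<close> turns the reciprocal relation into the
    marginal condition on the coupling density.\<close>
  have "ennreal (f x) * (\<integral>\<^sup>+y. ennreal (p x y) \<partial>b) = (\<integral>\<^sup>+y. ennreal (f x * p x y * g y) \<partial>N)" for x
  proof -
    have "(\<integral>\<^sup>+y. ennreal (p x y) \<partial>b) = (\<integral>\<^sup>+y. ennreal (g y) * ennreal (p x y) \<partial>N)"
      unfolding bg using sec by (intro nn_integral_density) auto
    also have "ennreal (f x) * \<dots> = (\<integral>\<^sup>+y. ennreal (f x) * (ennreal (g y) * ennreal (p x y)) \<partial>N)"
      using sec by (intro nn_integral_cmult[symmetric]) auto
    also have "\<dots> = (\<integral>\<^sup>+y. ennreal (f x * p x y * g y) \<partial>N)"
      using f_pos[of x] g_pos p_pos[of x]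
      by (intro nn_integral_cong) (simp add: less_imp_le mult_ac flip: ennreal_mult)
    finally show ?thesis .
  qed
  with f1 have f1': "AE x in M. (\<integral>\<^sup>+y. ennreal (f x * p x y * g y) \<partial>N) = 1" by simp
  have "ennreal (g y) * (\<integral>\<^sup>+x. ennreal (p x y) \<partial>a) = (\<integral>\<^sup>+x. ennreal (f x * p x y * g y) \<partial>M)" for y
  proof -
    have "(\<integral>\<^sup>+x. ennreal (p x y) \<partial>a) = (\<integral>\<^sup>+x. ennreal (f x) * ennreal (p x y) \<partial>M)"
      unfolding af using sec by (intro nn_integral_density) auto
    also have "ennreal (g y) * \<dots> = (\<integral>\<^sup>+x. ennreal (g y) * (ennreal (f x) * ennreal (p x y)) \<partial>M)"
      using sec by (intro nn_integral_cmult[symmetric]) auto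
    also have "\<dots> = (\<integral>\<^sup>+x. ennreal (f x * p x y * g y) \<partial>M)"
      using g_pos[of y] f_pos p_pos[of _ y]
      by (intro nn_integral_cong) (simp add: less_imp_le mult_ac flip: ennreal_mult)
    finally show ?thesis .
  qed
  with g1 have g1': "AE y in N. (\<integral>\<^sup>+x. ennreal (f x * p x y * g y) \<partial>M) = 1" by simp
  show thesis by (rule that[OF f g f_pos g_pos af bg f1' g1'])
qed

lemma density_cmult_eq_scale_measure:
  assumes [measurable]: "f \<in> borel_measurable M" "f' \<in> borel_measurable M"
    and "0 \<le> c" "\<And>x. 0 \<le> f x" and "AE x in M. f' x = c * (f x :: real)"
  shows "density M (\<lambda>x. ennreal (f' x)) = scale_measure (ennreal c) (density M (\<lambda>x. ennreal (f x)))"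
proof (rule measure_eqI)
  fix A assume "A \<in> sets (density M (\<lambda>x. ennreal (f' x)))"
  then have [measurable]: "A \<in> sets M" by simp
  have "(\<integral>\<^sup>+x. ennreal (f' x) * indicator A x \<partial>M) = (\<integral>\<^sup>+x. ennreal c * (ennreal (f x) * indicator A x) \<partial>M)"
    using assms(5) by (intro nn_integral_cong_AE)
      (auto simp: ennreal_mult assms(3,4) mult.assoc elim!: eventually_mono)
  then show "emeasure (density M (\<lambda>x. ennreal (f' x))) A
      = emeasure (scale_measure (ennreal c) (density M (\<lambda>x. ennreal (f x)))) A"
    by (simp add: emeasure_density nn_integral_cmult)
qed simp

lemma schroedinger_solution_unique:
  fixes M :: "'a::topological_space measure" and N :: "'b::topological_space measure"
  assumes "prob_space M" "prob_space N" "sets M = sets borel" "sets N = sets borel"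
    and p: "case_prod p \<in> borel_measurable (M \<Otimes>\<^sub>M N)" and p_pos: "\<And>x y. 0 < p x y"
    and sol: "schroedinger_solution p M N a b" "schroedinger_solution p M N a' b'"
  obtains \<kappa> :: real where "0 < \<kappa>" "a' = scale_measure (ennreal (inverse \<kappa>)) a"
    "b' = scale_measure (ennreal \<kappa>) b"
proof -
  obtain f g where fg: "f \<in> borel_measurable M" "g \<in> borel_measurable N" "\<And>x. 0 < f x" "\<And>y. 0 < g y"
    "a = density M (\<lambda>x. ennreal (f x))" "b = density N (\<lambda>y. ennreal (g y))"
    "AE x in M. (\<integral>\<^sup>+y. ennreal (f x * p x y * g y) \<partial>N) = 1"
    "AE y in N. (\<integral>\<^sup>+x. ennreal (f x * p x y * g y) \<partial>M) = 1"
    using schroedinger_solution_factors[OF assms(1-6) sol(1)] by blast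
  obtain f' g' where fg': "f' \<in> borel_measurable M" "g' \<in> borel_measurable N" "\<And>x. 0 < f' x" "\<And>y. 0 < g' y"
    "a' = density M (\<lambda>x. ennreal (f' x))" "b' = density N (\<lambda>y. ennreal (g' y))"
    "AE x in M. (\<integral>\<^sup>+y. ennreal (f' x * p x y * g' y) \<partial>N) = 1"
    "AE y in N. (\<integral>\<^sup>+x. ennreal (f' x * p x y * g' y) \<partial>M) = 1"
    using schroedinger_solution_factors[OF assms(1-6) sol(2)] by blast
  obtain \<kappa> where \<kappa>: "0 < \<kappa>" "AE x in M. f' x = inverse \<kappa> * f x" "AE y in N. g' y = \<kappa> * g y"
    using schroedinger_factors_unique[OF assms(1,2) p p_pos fg(1) fg'(1) fg(2) fg'(2)
        fg(3) fg'(3) fg(4) fg'(4) fg(7,8) fg'(7,8)] by blast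
  show thesis
    unfolding fg(5,6) fg'(5,6)
    by (rule that[OF \<kappa>(1)]; unfold fg(5,6) fg'(5,6); rule density_cmult_eq_scale_measure)
      (use \<kappa> fg fg' in \<open>auto simp: less_imp_le\<close>)
qed

section \<open>Radial kernels on Euclidean space\<close>

theorem corollary1p10:
  fixes \<mu> \<nu> :: "(real ^ 'n) measure"
    and p :: "real ^ 'n \<Rightarrow> real ^ 'n \<Rightarrow> real"
    and \<theta> :: "real \<Rightarrow> real"
  assumes "prob_space \<mu>" and "sets \<mu> = sets borel"
    and "prob_space \<nu>" and "sets \<nu> = sets borel"
    and "\<And>x y. p x y = \<theta> (norm (y - x))"
    and "\<And>r. r \<ge> 0 \<Longrightarrow> \<theta> r > 0"
    and "bounded (\<theta> ` {0..})"
    and "continuous_on {0..} \<theta>"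
    and "\<exists>L\<ge>0. antimono_on {L..} \<theta>"
  shows "(\<exists>a b. schroedinger_solution p \<mu> \<nu> a b) \<and>
    (\<forall>a b a' b'. schroedinger_solution p \<mu> \<nu> a b \<and> schroedinger_solution p \<mu> \<nu> a' b' \<longrightarrow>
      (\<exists>\<kappa>::real. \<kappa> > 0 \<and> a' = scale_measure (ennreal (inverse \<kappa>)) a
        \<and> b' = scale_measure (ennreal \<kappa>) b))"
proof -
  interpret \<mu>: prob_space \<mu> by fact
  interpret \<nu>: prob_space \<nu> by fact
  have sp: "space \<mu> = UNIV" "space \<nu> = UNIV"
    using sets_eq_imp_space_eq[OF assms(2)] sets_eq_imp_space_eq[OF assms(4)] by simp_all
  have p_pos: "0 < p x y" for x y using assms(5,6) by simp
  obtain C where "\<And>r. r \<ge> 0 \<Longrightarrow> \<bar>\<theta> r\<bar> \<le> C"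
    using assms(7) unfolding bounded_iff by auto
  then have p_le: "p x y \<le> C" for x y
    using abs_le_D1[of "\<theta> (norm (y - x))" C] unfolding assms(5) by simp
  have "continuous_on UNIV (\<lambda>z. \<theta> (norm (snd z - fst z :: real ^ 'n)))"
    by (rule continuous_on_compose2[OF assms(8)]) (auto intro!: continuous_intros)
  then have "case_prod p \<in> borel_measurable borel"
    by (simp add: borel_measurable_continuous_onI case_prod_beta' assms(5))
  moreover have "sets (\<mu> \<Otimes>\<^sub>M \<nu>) = sets (borel :: ((real ^ 'n) \<times> (real ^ 'n)) measure)"
    unfolding borel_prod[symmetric] by (intro sets_pair_measure_cong assms)
  ultimately have p_meas: "case_prod p \<in> borel_measurable (\<mu> \<Otimes>\<^sub>M \<nu>)"
    by (subst measurable_cong_sets[OF _ refl])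
  \<comment> \<open>Two balls, each of mass above one half, give the required total above 1. The
    bound for all larger radii allows a common radius for both measures.\<close>
  have ball: "\<exists>R\<ge>0. \<forall>r\<ge>R. 1 / 2 < measure M (cball 0 r)"
    if "prob_space M" "sets M = sets borel" for M :: "(real ^ 'n) measure"
  proof -
    interpret prob_space M by fact
    have "(\<lambda>n. measure M (cball 0 (real n))) \<longlonglongrightarrow> measure M (\<Union>n. cball 0 (real n))"
      by (rule finite_Lim_measure_incseq) (auto simp: that(2) incseq_def)
    moreover have "(\<Union>n. cball 0 (real n)) = space M"
      using real_arch_simple sets_eq_imp_space_eq[OF that(2)] by auto
    ultimately have "(\<lambda>n. measure M (cball 0 (real n))) \<longlonglongrightarrow> 1" using prob_space by simp
    then obtain n where n: "1 / 2 < measure M (cball 0 (real n))"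
      using order_tendstoD(1)[of _ 1 sequentially "1 / 2"] by (fastforce simp: eventually_sequentially)
    have "measure M (cball 0 (real n)) \<le> measure M (cball 0 r)" if "real n \<le> r" for r
      using that \<open>sets M = sets borel\<close> by (intro finite_measure_mono) auto
    then show ?thesis using n by (intro exI[of _ "real n"]) force
  qed
  obtain R1 R2 where "R1 \<ge> 0" "R2 \<ge> 0" "\<forall>r\<ge>R1. 1 / 2 < measure \<mu> (cball 0 r)" "\<forall>r\<ge>R2. 1 / 2 < measure \<nu> (cball 0 r)"
    using ball[OF assms(1,2)] ball[OF assms(3,4)] by blast
  then obtain R where R: "R \<ge> 0" "1 / 2 < measure \<mu> (cball 0 R)" "1 / 2 < measure \<nu> (cball 0 R)"
    by (meson max.cobounded1 max.cobounded2 order_trans)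
  \<comment> \<open>Only the monotonicity of \<open>m\<close> gives its measurability; \<open>max 0 t\<close> avoids the infimum of the empty set.\<close>
  define m where "m t = Inf (\<theta> ` {0..max 0 t})" for t
  have compact: "compact (\<theta> ` {0..max 0 t})" for t
    by (rule compact_continuous_image[OF continuous_on_subset[OF assms(8)]]) auto
  have bdd: "bdd_below (\<theta> ` {0..max 0 t})" for t
    using compact_imp_bounded[OF compact] by (rule bounded_imp_bdd_below)
  have m_pos: "0 < m t" for t
  proof -
    \<comment> \<open>By compactness the infimum is attained, hence it is a value of \<theta> and
      positive.\<close>
    have "m t \<in> \<theta> ` {0..max 0 t}"
      unfolding m_def by (rule closed_contains_Inf[OF _ bdd compact_imp_closed[OF compact]]) auto
    then show ?thesis using assms(6) by auto
  qed
  have m_le: "m t \<le> \<theta> r" if "0 \<le> r" "r \<le> t" for r t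
    unfolding m_def using that by (intro cInf_lower bdd) auto
  have "mono (\<lambda>t. - m t)"
    unfolding m_def by (intro monoI le_imp_neg_le cInf_superset_mono bdd) auto
  then have "(\<lambda>t. - (- m t)) \<in> borel_measurable borel"
    by (intro borel_measurable_uminus borel_measurable_mono)
  then have m_meas: "m \<in> borel_measurable borel" by simp
  have "(\<lambda>x. m (norm (x :: real ^ 'n) + R)) \<in> borel_measurable borel"
    by (rule measurable_compose[OF _ m_meas]) simp
  then have \<alpha>: "(\<lambda>x. m (norm x + R)) \<in> borel_measurable \<mu>" "(\<lambda>x. m (norm x + R)) \<in> borel_measurable \<nu>"
    by (simp_all add: measurable_cong_sets[OF assms(2) refl] measurable_cong_sets[OF assms(4) refl])
  have "\<exists>a b. schroedinger_solution p \<mu> \<nu> a b"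
  proof (rule schroedinger_solution_exists[OF assms(1,3,2,4) p_meas p_pos p_le _ _ _ \<alpha>])
    show "cball 0 R \<in> sets \<mu>" "cball 0 R \<in> sets \<nu>" using assms(2,4) by simp_all
    show "1 < measure \<mu> (cball 0 R) + measure \<nu> (cball 0 R)" using R by simp
    \<comment> \<open>For \<open>y\<close> in the ball the distance to \<open>x\<close> is at most
      \<open>norm x + R\<close>, which is where the argument of \<open>m\<close> comes from; by
      symmetry the same function serves for both variables.\<close>
    show "m (norm x + R) \<le> p x y" if "y \<in> cball 0 R" for x y
      unfolding assms(5) using that norm_triangle_ineq4[of y x] by (intro m_le) auto
    show "m (norm y + R) \<le> p x y" if "x \<in> cball 0 R" for x y
      unfolding assms(5) using that norm_triangle_ineq4[of y x] by (intro m_le) auto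
  qed (use m_pos in auto)
  moreover have "\<exists>\<kappa>::real. \<kappa> > 0 \<and> a' = scale_measure (ennreal (inverse \<kappa>)) a \<and> b' = scale_measure (ennreal \<kappa>) b"
    if "schroedinger_solution p \<mu> \<nu> a b" "schroedinger_solution p \<mu> \<nu> a' b'" for a b a' b'
    using schroedinger_solution_unique[OF assms(1,3,2,4) p_meas p_pos that] by metis
  ultimately show ?thesis by blast
qed

end
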